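(* Let $G$ be a discrete group and let $S$ be a $G$-$\mathrm{W}$-semigroup. Then the following conditions are equivalent: (i) $S$ has dynamical strict comparison. (ii) For $a,b\in S$ with $a\in I_G(b)$, if $\lambda(a)<\lambda(b)$ for all $\lambda\in\mathrm{St}^G(S)$ such that $\lambda(b)=1$, then $a\leq_Gb$. (iii) $S/G$ is almost unperforated. (iv) $\gamma(S/G)$ is almost unperforated.
   Context: For a relation $\prec$ on a set, $a^{\prec}=\{b: b\prec a\}$, and $a\leq_\prec b\iff a^\prec\subseteq b^\prec$. A $\mathrm{W}$-semigroup $(S,\prec)$ is an abelian monoid $S$ with a transitive relation $\prec$ such that: $0\prec a$ for all $a$; (W1) for each $a$ there is a sequence $(a_k)$ in $a^\prec$ with $a_k\prec a_{k+1}$ for all $k$ and such that every $b\prec a$ satisfies $b\prec a_k$ for some $k$; (W3) $a'\prec a$ and $b'\prec b$ imply $a'+b'\prec a+b$; (W4) $a\prec b+c$ implies there are $b'\prec b$, $c'\prec c$ with $a\prec b'+c'$. A $G$-$\mathrm{W}$-semigroup is a $\mathrm{W}$-semigroup with a $G$-action by additive maps with $a\prec b\Rightarrow ga\prec gb$. $\leq_G$ is the smallest preorder $\leq$ on $S$ such that any of the following implies $a\leq b$: $a^\prec\subseteq b^\prec$; $a=gb$ for some $g\in G$; $c\leq b$ for all $c\prec a$; $a=a_1+a_2$, $b=b_1+b_2$ with $a_k\leq b_k$ for $k=1,2$. $S/G$ is the antisymmetrization of $(S,\leq_G)$ with induced addition and $[a]\prec[b]\iff$ there is $a'$ with $a\leq_Ga'\prec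 b$. For a $\mathrm{W}$-semigroup $S$, $\gamma(S)$ is the set of $\prec$-increasing sequences $(a_n)$ modulo the antisymmetrization of: $(a_n)\precsim(b_n)$ iff for each $n$ there is $m$ with $a_n\prec b_m$; termwise addition, order $\leq$ induced by $\precsim$. $I_G(b)=\{z\in S:\text{ for any }z'\prec z\text{ there are }g_1,\dots,g_n\in G\text{ with }z'\prec\sum_{i=1}^ng_ib\}$. $\mathrm{St}^G(S)$ is the set of maps $\lambda\colon S\to[0,\infty]$ that are additive, zero-preserving, order-preserving for $\leq_\prec$, and $G$-invariant ($\lambda(ga)=\lambda(a)$); $\mathrm{F}_{\mathrm{W}}^G(S)$ is the subset of those with $\lambda(a)=\sup_{a'\prec a}\lambda(a')$ for all $a$. $S$ has dynamical strict comparison if for all $a,b\in S$ with $a\in I_G(b)$: if $\lambda(a)<\lambda(b)$ for all $\lambda\in\mathrm{F}_{\mathrm{W}}^G(S)$ with $0<\lambda(b)<\infty$, then $a\leq_Gb$. A $\mathrm{W}$-semigroup $(S,\prec)$ is almost unperforated if $(k+1)a\prec kb$ for some natural number $k$ implies $a^\prec\subseteq b^\prec$; the $\mathrm{Cu}$-semigroup $\gamma(S/G)$ is almost unperforated if $(k+1)a\leq kb$ for some natural number $k$ implies $a\leq b$. *)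

theory Defs
  imports "HOL-Algebra.Group_Action" "HOL-Algebra.FiniteProduct" "HOL-Library.Extended_Nonnegative_Real"
begin

text \<open>
  The abelian monoid underlying a W-semigroup is a commutative monoid of HOL-Algebra and hence is
  written multiplicatively: \<open>x \<otimes> y\<close> stands for \<open>x + y\<close>, \<open>\<one>\<close> for \<open>0\<close>, \<open>x [^] k\<close> for \<open>k x\<close>, and
  \<open>finprod\<close> for finite sums. The relation \<open>\<prec>\<close> is only meaningful on the carrier.
\<close>

record 'a w_semigroup = "'a monoid" +
  prec :: "'a \<Rightarrow> 'a \<Rightarrow> bool"  (infixl "\<prec>\<index>" 50)

definition below :: "('a, 'm) w_semigroup_scheme \<Rightarrow> 'a \<Rightarrow> 'a set" where
  "below S a = {b \<in> carrier S. b \<prec>\<^bsub>S\<^esub> a}"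

definition le_prec :: "('a, 'm) w_semigroup_scheme \<Rightarrow> 'a \<Rightarrow> 'a \<Rightarrow> bool" where
  "le_prec S a b \<longleftrightarrow> below S a \<subseteq> below S b"

locale W_semigroup = comm_monoid S for S (structure) +
  assumes prec_trans:
      "\<lbrakk>a \<in> carrier S; b \<in> carrier S; c \<in> carrier S; a \<prec> b; b \<prec> c\<rbrakk> \<Longrightarrow> a \<prec> c"
    and zero_prec: "a \<in> carrier S \<Longrightarrow> \<one> \<prec> a"
    and W1: "a \<in> carrier S \<Longrightarrow>
      \<exists>s :: nat \<Rightarrow> _. (\<forall>k. s k \<in> below S a) \<and> (\<forall>k. s k \<prec> s (Suc k)) \<and>
        (\<forall>b \<in> below S a. \<exists>k. b \<prec> s k)"
    and W3: "\<lbrakk>a \<in> carrier S; b \<in> carrier S; a' \<in> below S a; b' \<in> below S b\<rbrakk> \<Longrightarrow>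
      a' \<otimes> b' \<prec> a \<otimes> b"
    and W4: "\<lbrakk>a \<in> carrier S; b \<in> carrier S; c \<in> carrier S; a \<prec> b \<otimes> c\<rbrakk> \<Longrightarrow>
      \<exists>b' \<in> below S b. \<exists>c' \<in> below S c. a \<prec> b' \<otimes> c'"

locale GW_semigroup =
  W_semigroup S + group_action G "carrier S" \<phi>
  for G :: "('g, 'h) monoid_scheme" and S :: "('a, 'm) w_semigroup_scheme" and \<phi> +
  assumes action_add: "\<lbrakk>g \<in> carrier G; a \<in> carrier S; b \<in> carrier S\<rbrakk> \<Longrightarrow>
      \<phi> g (a \<otimes>\<^bsub>S\<^esub> b) = \<phi> g a \<otimes>\<^bsub>S\<^esub> \<phi> g b"
    and action_prec: "\<lbrakk>g \<in> carrier G; a \<in> carrier S; b \<in> carrier S; a \<prec>\<^bsub>S\<^esub> b\<rbrakk> \<Longrightarrow>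
      \<phi> g a \<prec>\<^bsub>S\<^esub> \<phi> g b"

inductive le_G ::
  "('g, 'h) monoid_scheme \<Rightarrow> ('a, 'm) w_semigroup_scheme \<Rightarrow> ('g \<Rightarrow> 'a \<Rightarrow> 'a) \<Rightarrow> 'a \<Rightarrow> 'a \<Rightarrow> bool"
  for G and S and \<phi> where
    le_G_refl: "a \<in> carrier S \<Longrightarrow> le_G G S \<phi> a a"
  | le_G_trans: "\<lbrakk>le_G G S \<phi> a b; le_G G S \<phi> b c\<rbrakk> \<Longrightarrow> le_G G S \<phi> a c"
  | le_G_prec: "\<lbrakk>a \<in> carrier S; b \<in> carrier S; le_prec S a b\<rbrakk> \<Longrightarrow> le_G G S \<phi> a b"
  | le_G_action: "\<lbrakk>b \<in> carrier S; g \<in> carrier G; a = \<phi> g b\<rbrakk> \<Longrightarrow> le_G G S \<phi> a b"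
  | le_G_approx: "\<lbrakk>a \<in> carrier S; b \<in> carrier S; \<forall>c \<in> below S a. le_G G S \<phi> c b\<rbrakk> \<Longrightarrow>
      le_G G S \<phi> a b"
  | le_G_add: "\<lbrakk>le_G G S \<phi> a1 b1; le_G G S \<phi> a2 b2; a = a1 \<otimes>\<^bsub>S\<^esub> a2; b = b1 \<otimes>\<^bsub>S\<^esub> b2\<rbrakk> \<Longrightarrow>
      le_G G S \<phi> a b"

definition antisym_rel :: "'a set \<Rightarrow> ('a \<Rightarrow> 'a \<Rightarrow> bool) \<Rightarrow> ('a \<times> 'a) set" where
  "antisym_rel A R = {(x, y) \<in> A \<times> A. R x y \<and> R y x}"

text \<open>
  On classes, operations and relations are defined through arbitrary representatives; in both
  quotients below the outcome does not depend on the representatives.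
\<close>

definition class_op :: "('a \<times> 'a) set \<Rightarrow> ('a \<Rightarrow> 'a \<Rightarrow> 'a) \<Rightarrow> 'a set \<Rightarrow> 'a set \<Rightarrow> 'a set" where
  "class_op r f A B = (\<Union>x\<in>A. \<Union>y\<in>B. r `` {f x y})"

definition quot_W ::
  "('g, 'h) monoid_scheme \<Rightarrow> ('a, 'm) w_semigroup_scheme \<Rightarrow> ('g \<Rightarrow> 'a \<Rightarrow> 'a) \<Rightarrow> 'a set w_semigroup"
where
  "quot_W G S \<phi> =
    (let r = antisym_rel (carrier S) (le_G G S \<phi>) in
      \<lparr> carrier = carrier S // r,
        monoid.mult = class_op r (mult S),
        one = r `` {\<one>\<^bsub>S\<^esub>},
        prec = (\<lambda>A B. \<exists>a\<in>A. \<exists>b\<in>B. \<exists>a'\<in>carrier S. le_G G S \<phi> a a' \<and> a' \<prec>\<^bsub>S\<^esub> b) \<rparr>)"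

record 'a ordered_monoid = "'a monoid" +
  ord_le :: "'a \<Rightarrow> 'a \<Rightarrow> bool"

definition prec_increasing :: "('a, 'm) w_semigroup_scheme \<Rightarrow> (nat \<Rightarrow> 'a) set" where
  "prec_increasing T = {s. \<forall>n. s n \<in> carrier T \<and> s n \<prec>\<^bsub>T\<^esub> s (Suc n)}"

definition precsim :: "('a, 'm) w_semigroup_scheme \<Rightarrow> (nat \<Rightarrow> 'a) \<Rightarrow> (nat \<Rightarrow> 'a) \<Rightarrow> bool" where
  "precsim T s t \<longleftrightarrow> (\<forall>n. \<exists>m. s n \<prec>\<^bsub>T\<^esub> t m)"

definition gamma_W :: "('a, 'm) w_semigroup_scheme \<Rightarrow> (nat \<Rightarrow> 'a) set ordered_monoid" where
  "gamma_W T =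
    (let r = antisym_rel (prec_increasing T) (precsim T) in
      \<lparr> carrier = prec_increasing T // r,
        monoid.mult = class_op r (\<lambda>s t n. s n \<otimes>\<^bsub>T\<^esub> t n),
        one = r `` {\<lambda>n. \<one>\<^bsub>T\<^esub>},
        ord_le = (\<lambda>A B. \<exists>s\<in>A. \<exists>t\<in>B. precsim T s t) \<rparr>)"

definition I_G ::
  "('g, 'h) monoid_scheme \<Rightarrow> ('a, 'm) w_semigroup_scheme \<Rightarrow> ('g \<Rightarrow> 'a \<Rightarrow> 'a) \<Rightarrow> 'a \<Rightarrow> 'a set"
where
  "I_G G S \<phi> b = {z \<in> carrier S. \<forall>z' \<in> below S z.
     \<exists>(n::nat) g. (\<forall>i\<in>{1..n}. g i \<in> carrier G) \<and>
       z' \<prec>\<^bsub>S\<^esub> finprod S (\<lambda>i. \<phi> (g i) b) {1..n}}"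

definition St_G ::
  "('g, 'h) monoid_scheme \<Rightarrow> ('a, 'm) w_semigroup_scheme \<Rightarrow> ('g \<Rightarrow> 'a \<Rightarrow> 'a) \<Rightarrow> ('a \<Rightarrow> ennreal) set"
where
  "St_G G S \<phi> = {l.
     (\<forall>a\<in>carrier S. \<forall>b\<in>carrier S. l (a \<otimes>\<^bsub>S\<^esub> b) = l a + l b) \<and>
     l \<one>\<^bsub>S\<^esub> = 0 \<and>
     (\<forall>a\<in>carrier S. \<forall>b\<in>carrier S. le_prec S a b \<longrightarrow> l a \<le> l b) \<and>
     (\<forall>g\<in>carrier G. \<forall>a\<in>carrier S. l (\<phi> g a) = l a)}"

definition F_W_G ::
  "('g, 'h) monoid_scheme \<Rightarrow> ('a, 'm) w_semigroup_scheme \<Rightarrow> ('g \<Rightarrow> 'a \<Rightarrow> 'a) \<Rightarrow> ('a \<Rightarrow> ennreal) set"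
where
  "F_W_G G S \<phi> = {l \<in> St_G G S \<phi>. \<forall>a\<in>carrier S. l a = (SUP a'\<in>below S a. l a')}"

definition dynamical_strict_comparison ::
  "('g, 'h) monoid_scheme \<Rightarrow> ('a, 'm) w_semigroup_scheme \<Rightarrow> ('g \<Rightarrow> 'a \<Rightarrow> 'a) \<Rightarrow> bool"
where
  "dynamical_strict_comparison G S \<phi> \<longleftrightarrow>
     (\<forall>a\<in>carrier S. \<forall>b\<in>carrier S. a \<in> I_G G S \<phi> b \<longrightarrow>
       (\<forall>l\<in>F_W_G G S \<phi>. 0 < l b \<and> l b < \<infinity> \<longrightarrow> l a < l b) \<longrightarrow> le_G G S \<phi> a b)"

definition almost_unperforated_W :: "('a, 'm) w_semigroup_scheme \<Rightarrow> bool" where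
  "almost_unperforated_W T \<longleftrightarrow>
     (\<forall>a\<in>carrier T. \<forall>b\<in>carrier T.
       (\<exists>k::nat. a [^]\<^bsub>T\<^esub> (k + 1) \<prec>\<^bsub>T\<^esub> b [^]\<^bsub>T\<^esub> k) \<longrightarrow> le_prec T a b)"

definition almost_unperforated_Cu :: "('a, 'm) ordered_monoid_scheme \<Rightarrow> bool" where
  "almost_unperforated_Cu T \<longleftrightarrow>
     (\<forall>a\<in>carrier T. \<forall>b\<in>carrier T.
       (\<exists>k::nat. ord_le T (a [^]\<^bsub>T\<^esub> (k + 1)) (b [^]\<^bsub>T\<^esub> k)) \<longrightarrow> ord_le T a b)"

end

theory Submission
  imports Defs
begin

text \<open>
  The preorder \<open>\<le>\<^sub>G\<close> is compatible with \<open>\<prec>\<close>: if \<open>c \<prec> a \<le>\<^sub>G b\<close>, then \<open>c \<le>\<^sub>G b' \<prec> b\<close> for some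
  \<open>b'\<close>. Hence \<open>S/G\<close> is a W-semigroup whose canonical preorder is \<open>\<le>\<^sub>G\<close>, and almost unperforation of
  \<open>S/G\<close> says that \<open>(k + 1) a \<le>\<^sub>G c \<prec> k b\<close> implies \<open>a \<le>\<^sub>G b\<close>. Comparing cofinal sequences gives
  (iii) \<open>\<longleftrightarrow>\<close> (iv).

  For (iii) \<open>\<longrightarrow>\<close> (ii), a Hahn-Banach argument for preordered monoids shows that, if \<open>a \<le> n b\<close> and
  \<open>\<lambda>(a) < 1\<close> for all states with \<open>\<lambda>(b) = 1\<close>, then \<open>(k + 1) a \<le> k b\<close> for some \<open>k\<close>. It is applied
  to \<open>\<le>\<^sub>G\<close> and to elements slightly below \<open>a\<close>. For (ii) \<open>\<longrightarrow>\<close> (i), replace a state \<open>\<lambda>\<close> by its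
  regularisation \<open>x \<mapsto> sup {\<lambda>(y) | y \<prec> x}\<close>, which lies in \<open>F_W_G\<close>. For (i) \<open>\<longrightarrow>\<close> (iii),
  elements of \<open>F_W_G\<close> respect \<open>\<le>\<^sub>G\<close>, so \<open>(k + 1) \<lambda>(a) \<le> k \<lambda>(b)\<close>.
\<close>

section \<open>States on preordered monoids\<close>

text \<open>Neither cancellation nor antisymmetry is assumed, so \<open>S\<close> itself with
  \<open>\<le>\<^sub>G\<close> is an instance and states need not be transported along a
  quotient.\<close>

locale preordered_monoid = comm_monoid M for M (structure) +
  fixes le :: "'a \<Rightarrow> 'a \<Rightarrow> bool" (infix "\<lesssim>" 50)
  assumes le_refl: "x \<in> carrier M \<Longrightarrow> x \<lesssim> x"
    and le_trans: "\<lbrakk>x \<in> carrier M; y \<in> carrier M; z \<in> carrier M; x \<lesssim> y; y \<lesssim> z\<rbrakk> \<Longrightarrow> x \<lesssim> z"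
    and le_mult_right: "\<lbrakk>x \<in> carrier M; y \<in> carrier M; z \<in> carrier M; x \<lesssim> y\<rbrakk> \<Longrightarrow> x \<otimes> z \<lesssim> y \<otimes> z"
    and one_le: "x \<in> carrier M \<Longrightarrow> \<one> \<lesssim> x"
begin

lemma le_mult:
  assumes [simp]: "x \<in> carrier M" "y \<in> carrier M" "z \<in> carrier M" "w \<in> carrier M"
    and "x \<lesssim> y" "z \<lesssim> w"
  shows "x \<otimes> z \<lesssim> y \<otimes> w"
  using le_trans[of "x \<otimes> z" "y \<otimes> z" "y \<otimes> w"] le_mult_right[of x y z] le_mult_right[of z w y] assms
  by (simp add: m_comm)

lemma le_multI1:
  assumes [simp]: "x \<in> carrier M" "y \<in> carrier M" "z \<in> carrier M" and "x \<lesssim> y"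
  shows "x \<lesssim> y \<otimes> z"
  using le_mult[of x y \<one> z] one_le[of z] assms by simp

lemma le_multD1:
  assumes [simp]: "x \<in> carrier M" "y \<in> carrier M" "z \<in> carrier M" and "x \<otimes> y \<lesssim> z"
  shows "x \<lesssim> z"
  using le_trans[of x "x \<otimes> y" z] le_multI1[of x x y] le_refl assms by simp

lemma pow_le_pow:
  assumes [simp]: "x \<in> carrier M" "y \<in> carrier M" and "x \<lesssim> y"
  shows "x [^] (n::nat) \<lesssim> y [^] n"
  by (induct n) (auto intro: le_refl le_mult assms)

lemma pow_le_pow_exp:
  assumes [simp]: "x \<in> carrier M" and "m \<le> (n::nat)"
  shows "x [^] m \<lesssim> x [^] n"
proof -
  have "x [^] n = x [^] m \<otimes> x [^] (n - m)"
    using assms by (simp add: nat_pow_mult)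
  then show ?thesis by (simp add: le_multI1 le_refl)
qed

text \<open>A substitute for cancellation: \<open>x\<close> acts as a catalyst that is recovered on
  the right after each exchange of a \<open>y\<close> for a \<open>z\<close>, so the exchange can be
  repeated.\<close>

lemma absorb_pow:
  assumes [simp]: "x \<in> carrier M" "y \<in> carrier M" "z \<in> carrier M"
    and le: "x \<otimes> y \<lesssim> x \<otimes> z"
  shows "x \<otimes> y [^] (n::nat) \<lesssim> x \<otimes> z [^] n"
proof (induct n)
  case 0 show ?case by (simp add: le_refl)
next
  case (Suc n)
  have "x \<otimes> y [^] n \<otimes> y \<lesssim> x \<otimes> z [^] n \<otimes> y"
    using Suc by (intro le_mult_right) auto
  moreover have "x \<otimes> y \<otimes> z [^] n \<lesssim> x \<otimes> z \<otimes> z [^] n"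
    using le by (intro le_mult_right) auto
  ultimately show ?case
    using le_trans[of "x \<otimes> y [^] Suc n" "x \<otimes> z [^] n \<otimes> y" "x \<otimes> z [^] Suc n"]
    by (simp add: m_ac)
qed

end

text \<open>A monotone real-valued state with value 1 at \<open>u\<close> rules out (k + 1) u <= k
  u. Thus \<open>unstable\<close> is necessary for such a state to exist;
  \<open>state_exists\<close> shows that it suffices.\<close>

locale order_unit_monoid = preordered_monoid +
  fixes u
  assumes unit_closed [simp]: "u \<in> carrier M"
    and order_unit: "x \<in> carrier M \<Longrightarrow> \<exists>n::nat. x \<lesssim> u [^] n"
    and unstable: "\<not> u [^] Suc k \<lesssim> u [^] k"
begin

lemma unit_pow_le:
  assumes "u [^] m \<lesssim> u [^] (n::nat)"
  shows "m \<le> n"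
proof (rule ccontr)
  assume "\<not> m \<le> n"
  then have "u [^] Suc n \<lesssim> u [^] m"
    by (intro pow_le_pow_exp) auto
  then show False
    using le_trans[of "u [^] Suc n" "u [^] m" "u [^] n"] assms unstable[of n] by simp
qed

text \<open>The second clause and subadditivity together give homogeneity for multiples. The value 0
  off the carrier makes the pointwise order of total functions a comparison on the carrier, which is
  the order used with Zorn's lemma.\<close>

definition sublinear :: "('a \<Rightarrow> real) \<Rightarrow> bool" where
  "sublinear q \<longleftrightarrow>
     (\<forall>x\<in>carrier M. \<forall>y\<in>carrier M. q (x \<otimes> y) \<le> q x + q y) \<and>
     (\<forall>x\<in>carrier M. \<forall>k. real k * q x \<le> q (x [^] k)) \<and>
     (\<forall>x\<in>carrier M. \<forall>y\<in>carrier M. x \<lesssim> y \<longrightarrow> q x \<le> q y) \<and>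
     (\<forall>x\<in>carrier M. q (x \<otimes> u) = q x + 1) \<and>
     (\<forall>x. x \<notin> carrier M \<longrightarrow> q x = 0)"

lemma sublinearD:
  assumes "sublinear q"
  shows "\<lbrakk>x \<in> carrier M; y \<in> carrier M\<rbrakk> \<Longrightarrow> q (x \<otimes> y) \<le> q x + q y"
    and "x \<in> carrier M \<Longrightarrow> real k * q x \<le> q (x [^] k)"
    and "\<lbrakk>x \<in> carrier M; y \<in> carrier M; x \<lesssim> y\<rbrakk> \<Longrightarrow> q x \<le> q y"
    and "x \<in> carrier M \<Longrightarrow> q (x \<otimes> u) = q x + 1"
    and "x \<notin> carrier M \<Longrightarrow> q x = 0"
  using assms unfolding sublinear_def by blast+

text \<open>Subadditivity gives q(0) <= 2 q(0), and the second clause with factor 2 gives the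
  reverse inequality.\<close>

lemma sublinear_one: "sublinear q \<Longrightarrow> q \<one> = 0"
  using sublinearD(1)[of q \<one> \<one>] sublinearD(2)[of q \<one> 2] by simp

lemma sublinear_nonneg: "sublinear q \<Longrightarrow> 0 \<le> q x"
  using sublinear_one[of q] sublinearD(3)[of q \<one> x] sublinearD(5)[of q x] one_le[of x]
  by (cases "x \<in> carrier M") auto

text \<open>The values \<open>r\<close> to which \<open>m x + l u \<le> n u\<close> forces \<open>\<lambda>(x) \<le> r\<close> in every normalised state \<open>\<lambda>\<close>.
  The summand \<open>l u\<close> makes the infimum additive along \<open>u\<close>.\<close>

definition bounds :: "'a \<Rightarrow> real set" where
  "bounds x = {(real n - real l) / real m | n l m. 0 < m \<and> x [^] m \<otimes> u [^] l \<lesssim> u [^] n}"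

lemma boundsI: "\<lbrakk>0 < m; x [^] m \<otimes> u [^] l \<lesssim> u [^] n; r = (real n - real l) / real m\<rbrakk> \<Longrightarrow> r \<in> bounds x"
  unfolding bounds_def by blast

lemma boundsE:
  assumes "r \<in> bounds x"
  obtains n l m :: nat where "0 < m" "x [^] m \<otimes> u [^] l \<lesssim> u [^] n" "r = (real n - real l) / real m"
  using assms unfolding bounds_def by blast

lemma bounds_nonempty: "x \<in> carrier M \<Longrightarrow> bounds x \<noteq> {}"
proof -
  assume x: "x \<in> carrier M"
  then obtain n :: nat where "x \<lesssim> u [^] n" using order_unit by blast
  then have "real n \<in> bounds x"
    using x by (intro boundsI[of 1 x 0 n]) auto
  then show ?thesis by blast
qed

text \<open>Here \<open>unstable\<close> enters, through \<open>unit_pow_le\<close>: discarding the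
  summand m x leaves l u <= n u, hence l <= n.\<close>

lemma bounds_nonneg:
  assumes [simp]: "x \<in> carrier M" and "r \<in> bounds x"
  shows "0 \<le> r"
proof -
  obtain n l m :: nat where 1: "0 < m" "x [^] m \<otimes> u [^] l \<lesssim> u [^] n" "r = (real n - real l) / real m"
    using assms(2) by (rule boundsE)
  have "u [^] l \<lesssim> u [^] n"
    using 1(2) by (intro le_multD1[of "u [^] l" "x [^] m"]) (auto simp: m_comm)
  then have "l \<le> n" by (rule unit_pow_le)
  then show ?thesis using 1 by simp
qed

lemma Inf_bounds_le: "\<lbrakk>x \<in> carrier M; r \<in> bounds x\<rbrakk> \<Longrightarrow> Inf (bounds x) \<le> r"
  by (rule cInf_lower) (auto intro!: bdd_belowI bounds_nonneg)

lemma Inf_bounds_ge: "\<lbrakk>x \<in> carrier M; \<And>r. r \<in> bounds x \<Longrightarrow> c \<le> r\<rbrakk> \<Longrightarrow> c \<le> Inf (bounds x)"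
  by (rule cInf_greatest) (auto simp: bounds_nonempty)

text \<open>The two inequalities are multiplied by \<open>m'\<close> and \<open>m\<close>
  respectively and added, which gives the common denominator m m'.\<close>

lemma bounds_mult:
  assumes [simp]: "x \<in> carrier M" "y \<in> carrier M" and "r \<in> bounds x" "s \<in> bounds y"
  shows "r + s \<in> bounds (x \<otimes> y)"
proof -
  obtain n l m :: nat where 1: "0 < m" "x [^] m \<otimes> u [^] l \<lesssim> u [^] n" "r = (real n - real l) / real m"
    using assms(3) by (rule boundsE)
  obtain n' l' m' :: nat
    where 2: "0 < m'" "y [^] m' \<otimes> u [^] l' \<lesssim> u [^] n'" "s = (real n' - real l') / real m'"
    using assms(4) by (rule boundsE)
  have "(x [^] m \<otimes> u [^] l) [^] m' \<otimes> (y [^] m' \<otimes> u [^] l') [^] m \<lesssim> (u [^] n) [^] m' \<otimes> (u [^] n') [^] m"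
    using 1 2 by (intro le_mult pow_le_pow) auto
  moreover have "(x [^] m \<otimes> u [^] l) [^] m' \<otimes> (y [^] m' \<otimes> u [^] l') [^] m
      = (x \<otimes> y) [^] (m * m') \<otimes> u [^] (l * m' + l' * m)"
    by (simp add: nat_pow_distrib nat_pow_pow nat_pow_mult[symmetric] m_ac mult.commute)
  moreover have "(u [^] n) [^] m' \<otimes> (u [^] n') [^] m = u [^] (n * m' + n' * m)"
    by (simp add: nat_pow_pow nat_pow_mult)
  moreover have "r + s = (real (n * m' + n' * m) - real (l * m' + l' * m)) / real (m * m')"
    unfolding 1(3) 2(3) using 1(1) 2(1) by (simp add: field_simps)
  ultimately show ?thesis
    using 1(1) 2(1) by (intro boundsI[of "m * m'" _ "l * m' + l' * m" "n * m' + n' * m"]) auto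
qed

lemma bounds_pow:
  assumes [simp]: "x \<in> carrier M" and "0 < k" "r \<in> bounds (x [^] k)"
  shows "r / real k \<in> bounds x"
proof -
  obtain n l m :: nat
    where 1: "0 < m" "(x [^] k) [^] m \<otimes> u [^] l \<lesssim> u [^] n" "r = (real n - real l) / real m"
    using assms(3) by (rule boundsE)
  show ?thesis
    by (rule boundsI[of "k * m" _ l n]) (use 1 assms(2) in \<open>auto simp: nat_pow_pow field_simps\<close>)
qed

lemma bounds_mono:
  assumes [simp]: "x \<in> carrier M" "y \<in> carrier M" and "x \<lesssim> y" "r \<in> bounds y"
  shows "r \<in> bounds x"
proof -
  obtain n l m :: nat where 1: "0 < m" "y [^] m \<otimes> u [^] l \<lesssim> u [^] n" "r = (real n - real l) / real m"
    using assms(4) by (rule boundsE)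
  have "x [^] m \<otimes> u [^] l \<lesssim> y [^] m \<otimes> u [^] l"
    using assms(3) by (intro le_mult_right pow_le_pow) auto
  then have "x [^] m \<otimes> u [^] l \<lesssim> u [^] n"
    using 1(2) le_trans[of "x [^] m \<otimes> u [^] l" "y [^] m \<otimes> u [^] l" "u [^] n"] by simp
  then show ?thesis using 1 by (intro boundsI)
qed

lemma bounds_mult_unit:
  assumes [simp]: "x \<in> carrier M"
  shows "r + 1 \<in> bounds (x \<otimes> u) \<longleftrightarrow> r \<in> bounds x"
proof
  assume "r \<in> bounds x"
  moreover have "1 \<in> bounds u" by (rule boundsI[of 1 _ 0 1]) (auto intro: le_refl)
  ultimately show "r + 1 \<in> bounds (x \<otimes> u)" by (intro bounds_mult) auto
next
  assume "r + 1 \<in> bounds (x \<otimes> u)"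
  then obtain n l m :: nat
    where 1: "0 < m" "(x \<otimes> u) [^] m \<otimes> u [^] l \<lesssim> u [^] n" "r + 1 = (real n - real l) / real m"
    by (rule boundsE)
  \<comment> \<open>The \<open>m\<close> copies of \<open>u\<close> are absorbed by the exponent
    \<open>l\<close>, which lowers the bound by exactly 1.\<close>
  have "(x \<otimes> u) [^] m \<otimes> u [^] l = x [^] m \<otimes> u [^] (l + m)"
    by (simp add: nat_pow_distrib nat_pow_mult[symmetric] m_ac)
  then show "r \<in> bounds x"
    using 1 by (intro boundsI[of m _ "l + m" n]) (auto simp: field_simps)
qed

text \<open>The starting point for Zorn's lemma: sublinear functionals exist, so the empty chain has
  a bound.\<close>

lemma sublinear_Inf_bounds: "sublinear (\<lambda>x. if x \<in> carrier M then Inf (bounds x) else 0)"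
  unfolding sublinear_def
proof (intro conjI ballI allI impI)
  fix x y assume [simp]: "x \<in> carrier M" "y \<in> carrier M"
  \<comment> \<open>The two bounds vary independently, so the infimum is taken in one variable at a
    time.\<close>
  have "Inf (bounds (x \<otimes> y)) - s \<le> r" if "r \<in> bounds x" "s \<in> bounds y" for r s
    using Inf_bounds_le[of "x \<otimes> y" "r + s"] bounds_mult[of x y r s] that by simp
  then have "Inf (bounds (x \<otimes> y)) - s \<le> Inf (bounds x)" if "s \<in> bounds y" for s
    using that by (intro Inf_bounds_ge) auto
  then have "Inf (bounds (x \<otimes> y)) - Inf (bounds x) \<le> Inf (bounds y)"
    by (intro Inf_bounds_ge) (auto simp: algebra_simps)
  then show "(if x \<otimes> y \<in> carrier M then Inf (bounds (x \<otimes> y)) else 0)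
      \<le> (if x \<in> carrier M then Inf (bounds x) else 0) + (if y \<in> carrier M then Inf (bounds y) else 0)"
    by simp
next
  fix x k assume [simp]: "x \<in> carrier M"
  have "real k * Inf (bounds x) \<le> Inf (bounds (x [^] k))"
  proof (cases "k = 0")
    case True
    then show ?thesis using Inf_bounds_ge[of \<one> 0] bounds_nonneg[of \<one>] by simp
  next
    case False
    then have "real k * Inf (bounds x) \<le> r" if "r \<in> bounds (x [^] k)" for r
      using Inf_bounds_le[of x "r / real k"] bounds_pow[of x k r] that by (simp add: field_simps)
    then show ?thesis by (intro Inf_bounds_ge) auto
  qed
  then show "real k * (if x \<in> carrier M then Inf (bounds x) else 0)
      \<le> (if x [^] k \<in> carrier M then Inf (bounds (x [^] k)) else 0)" by simp
next
  fix x y assume "x \<in> carrier M" "y \<in> carrier M" "x \<lesssim> y"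
  then show "(if x \<in> carrier M then Inf (bounds x) else 0) \<le> (if y \<in> carrier M then Inf (bounds y) else 0)"
    using Inf_bounds_ge[of y "Inf (bounds x)"] Inf_bounds_le[of x] bounds_mono[of x y] by auto
next
  fix x assume [simp]: "x \<in> carrier M"
  have "Inf (bounds (x \<otimes> u)) - 1 \<le> Inf (bounds x)"
    using Inf_bounds_le[of "x \<otimes> u"] bounds_mult_unit[of x] by (intro Inf_bounds_ge) (auto simp: algebra_simps)
  moreover have "Inf (bounds x) + 1 \<le> Inf (bounds (x \<otimes> u))"
    using Inf_bounds_le[of x "r - 1" for r] bounds_mult_unit[of x "r - 1" for r]
    by (intro Inf_bounds_ge) (auto simp: algebra_simps)
  ultimately show "(if x \<otimes> u \<in> carrier M then Inf (bounds (x \<otimes> u)) else 0)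
      = (if x \<in> carrier M then Inf (bounds x) else 0) + 1" by simp
qed auto

text \<open>The Hahn-Banach modification in the direction \<open>y\<close>: for sublinear
  \<open>q\<close> the terms decrease with \<open>n\<close>, and their limit is additive along
  \<open>y\<close> while staying below \<open>q\<close>.\<close>

definition linearise :: "('a \<Rightarrow> real) \<Rightarrow> 'a \<Rightarrow> 'a \<Rightarrow> real" where
  "linearise q y x = (if x \<in> carrier M then INF n. q (x \<otimes> y [^] n) - real n * q y else 0)"

context
  fixes q y
  assumes q: "sublinear q" and y [simp]: "y \<in> carrier M"
begin

text \<open>The inequality n q(y) <= q(n y) and monotonicity bound the terms below, so that their
  real infimum is meaningful.\<close>

lemma linearise_term_nonneg:
  assumes [simp]: "x \<in> carrier M"
  shows "0 \<le> q (x \<otimes> y [^] n) - real n * q y"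
proof -
  have "real n * q y \<le> q (y [^] n)" using sublinearD(2)[OF q] by simp
  also have "\<dots> \<le> q (x \<otimes> y [^] n)"
    using le_multI1[of "y [^] n" "y [^] n" x] le_refl[of "y [^] n"]
    by (intro sublinearD(3)[OF q]) (auto simp: m_comm)
  finally show ?thesis by simp
qed

lemma linearise_le_term:
  assumes "x \<in> carrier M"
  shows "linearise q y x \<le> q (x \<otimes> y [^] n) - real n * q y"
  using assms linearise_term_nonneg unfolding linearise_def
  by (auto intro!: cINF_lower bdd_belowI2[where m = 0])

lemma linearise_ge:
  assumes "x \<in> carrier M" "\<And>n. c \<le> q (x \<otimes> y [^] n) - real n * q y"
  shows "c \<le> linearise q y x"
  using assms unfolding linearise_def by (auto intro!: cINF_greatest)

lemma linearise_le:
  assumes [simp]: "x \<in> carrier M"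
  shows "linearise q y x \<le> q x"
  using linearise_le_term[of x 0] by simp

text \<open>One more \<open>y\<close> raises \<open>q\<close> by at most q(y). This lets the infimum
  be compared along the sparser exponents k n that arise from multiples.\<close>

lemma linearise_term_decreasing:
  assumes [simp]: "x \<in> carrier M" and "m \<le> n"
  shows "q (x \<otimes> y [^] n) - real n * q y \<le> q (x \<otimes> y [^] m) - real m * q y"
  using assms(2)
proof (induct rule: dec_induct)
  case (step n)
  have "q (x \<otimes> y [^] n \<otimes> y) \<le> q (x \<otimes> y [^] n) + q y"
    by (intro sublinearD(1)[OF q]) auto
  then show ?case using step by (simp add: m_assoc algebra_simps)
qed auto

lemma sublinear_linearise: "sublinear (linearise q y)"
  unfolding sublinear_def
proof (intro conjI ballI allI impI)
  fix x z assume [simp]: "x \<in> carrier M" "z \<in> carrier M"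
  \<comment> \<open>Exponents \<open>n\<close> and \<open>m\<close> chosen independently for the two
    summands meet at n + m, so the two infima can be taken separately.\<close>
  have *: "linearise q y (x \<otimes> z)
      \<le> (q (x \<otimes> y [^] n) - real n * q y) + (q (z \<otimes> y [^] m) - real m * q y)" for n m
  proof -
    have "linearise q y (x \<otimes> z) \<le> q (x \<otimes> z \<otimes> y [^] (n + m)) - real (n + m) * q y"
      by (rule linearise_le_term) simp
    also have "x \<otimes> z \<otimes> y [^] (n + m) = (x \<otimes> y [^] n) \<otimes> (z \<otimes> y [^] m)"
      by (simp add: nat_pow_mult[symmetric] m_ac)
    also have "q \<dots> \<le> q (x \<otimes> y [^] n) + q (z \<otimes> y [^] m)"
      by (intro sublinearD(1)[OF q]) auto
    finally show ?thesis by (simp add: algebra_simps)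
  qed
  have "linearise q y (x \<otimes> z) - (q (z \<otimes> y [^] m) - real m * q y) \<le> linearise q y x" for m
    using * by (intro linearise_ge) (auto simp: algebra_simps)
  then have "linearise q y (x \<otimes> z) - linearise q y x \<le> linearise q y z"
    by (intro linearise_ge) (auto simp: algebra_simps)
  then show "linearise q y (x \<otimes> z) \<le> linearise q y x + linearise q y z" by simp
next
  fix x and k :: nat assume [simp]: "x \<in> carrier M"
  show "real k * linearise q y x \<le> linearise q y (x [^] k)"
  proof (cases "k = 0")
    case True
    then show ?thesis using linearise_term_nonneg[of \<one>] by (auto intro!: linearise_ge)
  next
    case False
    show ?thesis
    proof (rule linearise_ge)
      fix n
      have "real k * linearise q y x \<le> real k * q (x \<otimes> y [^] n) - real (k * n) * q y"
        using mult_left_mono[OF linearise_le_term[of x n], of "real k"] by (simp add: algebra_simps)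
      also have "real k * q (x \<otimes> y [^] n) \<le> q ((x \<otimes> y [^] n) [^] k)"
        by (intro sublinearD(2)[OF q]) auto
      also have "(x \<otimes> y [^] n) [^] k = x [^] k \<otimes> y [^] (k * n)"
        by (simp add: nat_pow_distrib nat_pow_pow mult.commute)
      \<comment> \<open>Since \<open>k\<close> is nonzero, k n >= n, and the later term is the
        smaller one.\<close>
      also have "q (x [^] k \<otimes> y [^] (k * n)) - real (k * n) * q y \<le> q (x [^] k \<otimes> y [^] n) - real n * q y"
        using False by (intro linearise_term_decreasing) auto
      finally show "real k * linearise q y x \<le> q (x [^] k \<otimes> y [^] n) - real n * q y" by simp
    qed simp
  qed
next
  fix x z assume [simp]: "x \<in> carrier M" "z \<in> carrier M" and "x \<lesssim> z"
  show "linearise q y x \<le> linearise q y z"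
  proof (rule linearise_ge)
    fix n
    have "linearise q y x \<le> q (x \<otimes> y [^] n) - real n * q y" by (rule linearise_le_term) simp
    also have "q (x \<otimes> y [^] n) \<le> q (z \<otimes> y [^] n)"
      using \<open>x \<lesssim> z\<close> by (intro sublinearD(3)[OF q] le_mult_right) auto
    finally show "linearise q y x \<le> q (z \<otimes> y [^] n) - real n * q y" by simp
  qed simp
next
  fix x assume [simp]: "x \<in> carrier M"
  have "x \<otimes> u \<otimes> y [^] n = x \<otimes> y [^] n \<otimes> u" for n :: nat
    by (simp add: m_ac)
  then have "q (x \<otimes> u \<otimes> y [^] n) = q (x \<otimes> y [^] n) + 1" for n :: nat
    using sublinearD(4)[OF q, of "x \<otimes> y [^] n"] by simp
  then have *: "q (x \<otimes> u \<otimes> y [^] n) - real n * q y = q (x \<otimes> y [^] n) - real n * q y + 1" for n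
    by simp
  have "linearise q y (x \<otimes> u) - 1 \<le> linearise q y x"
    using linearise_le_term[of "x \<otimes> u"] * by (intro linearise_ge) (auto simp: algebra_simps)
  moreover have "linearise q y x + 1 \<le> linearise q y (x \<otimes> u)"
    using linearise_le_term[of x] * by (intro linearise_ge) (auto simp: algebra_simps)
  ultimately show "linearise q y (x \<otimes> u) = linearise q y x + 1" by simp
qed (simp add: linearise_def)

end

text \<open>The bound is the pointwise infimum, finite because sublinear functionals are
  nonnegative. Comparability in the chain serves subadditivity, where two members have to be
  replaced by one below both.\<close>

lemma sublinear_chain_lower_bound:
  assumes sub: "\<And>q. q \<in> C \<Longrightarrow> sublinear q"
    and chain: "\<And>p q. \<lbrakk>p \<in> C; q \<in> C\<rbrakk> \<Longrightarrow> p \<le> q \<or> q \<le> p"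
  shows "\<exists>p. sublinear p \<and> (\<forall>q\<in>C. p \<le> q)"
proof (cases "C = {}")
  case True
  then show ?thesis using sublinear_Inf_bounds by blast
next
  case False
  define p where "p x = (INF q\<in>C. q x)" for x
  have lower: "p x \<le> q x" if "q \<in> C" for q x
    unfolding p_def using that sublinear_nonneg[OF sub]
    by (intro cINF_lower) (auto intro!: bdd_belowI2[where m = 0])
  have greatest: "c \<le> p x" if "\<And>q. q \<in> C \<Longrightarrow> c \<le> q x" for c x
    unfolding p_def using that False by (intro cINF_greatest) auto
  have "sublinear p"
    unfolding sublinear_def
  proof (intro conjI ballI allI impI)
    fix x y assume [simp]: "x \<in> carrier M" "y \<in> carrier M"
    have *: "p (x \<otimes> y) \<le> q x + q' y" if "q \<in> C" "q' \<in> C" for q q'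
    proof -
      from chain[OF that] that obtain r where r: "r \<in> C" "r \<le> q" "r \<le> q'"
        by auto
      have "p (x \<otimes> y) \<le> r (x \<otimes> y)" using r lower by blast
      also have "\<dots> \<le> r x + r y" using sublinearD(1)[OF sub[OF r(1)]] by simp
      also have "\<dots> \<le> q x + q' y" using r(2,3) by (intro add_mono) (auto simp: le_fun_def)
      finally show ?thesis .
    qed
    have "p (x \<otimes> y) - q' y \<le> p x" if "q' \<in> C" for q'
      using *[OF _ that] by (intro greatest) (auto simp: algebra_simps)
    then have "p (x \<otimes> y) - p x \<le> p y"
      by (intro greatest) (auto simp: algebra_simps)
    then show "p (x \<otimes> y) \<le> p x + p y" by simp
  next
    fix x and k :: nat assume [simp]: "x \<in> carrier M"
    show "real k * p x \<le> p (x [^] k)"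
    proof (rule greatest)
      fix q assume "q \<in> C"
      then have "real k * p x \<le> real k * q x" using lower by (intro mult_left_mono) auto
      also have "\<dots> \<le> q (x [^] k)" using sublinearD(2)[OF sub[OF \<open>q \<in> C\<close>]] by simp
      finally show "real k * p x \<le> q (x [^] k)" .
    qed
  next
    fix x y assume "x \<in> carrier M" "y \<in> carrier M" "x \<lesssim> y"
    then show "p x \<le> p y"
      using lower sublinearD(3)[OF sub] by (intro greatest) (meson order_trans)
  next
    fix x assume [simp]: "x \<in> carrier M"
    have *: "q (x \<otimes> u) = q x + 1" if "q \<in> C" for q
      using sublinearD(4)[OF sub[OF that]] by simp
    have "p (x \<otimes> u) - 1 \<le> p x"
      using lower[of _ "x \<otimes> u"] * by (intro greatest) (force simp: algebra_simps)
    moreover have "p x + 1 \<le> p (x \<otimes> u)"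
      using lower[of _ x] * by (intro greatest) (force simp: algebra_simps)
    ultimately show "p (x \<otimes> u) = p x + 1" by simp
  next
    fix x assume "x \<notin> carrier M"
    then have "q x = 0" if "q \<in> C" for q using sublinearD(5)[OF sub[OF that]] by simp
    then have "p x = (INF q\<in>C. 0)" unfolding p_def by (rule INF_cong[OF refl])
    then show "p x = 0" using False by simp
  qed
  then show ?thesis using lower by (auto simp: le_fun_def)
qed

text \<open>A minimal sublinear functional equals all of its linearisations, which makes it additive.\<close>

theorem state_exists:
  obtains q :: "'a \<Rightarrow> real" where "\<And>x. x \<in> carrier M \<Longrightarrow> 0 \<le> q x"
    "\<And>x y. \<lbrakk>x \<in> carrier M; y \<in> carrier M\<rbrakk> \<Longrightarrow> q (x \<otimes> y) = q x + q y"
    "\<And>x y. \<lbrakk>x \<in> carrier M; y \<in> carrier M; x \<lesssim> y\<rbrakk> \<Longrightarrow> q x \<le> q y"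
    "q u = 1"
proof -
  \<comment> \<open>The order is reversed, so the maximal element supplied by Zorn's lemma is a
    minimal functional.\<close>
  have "\<exists>m\<in>{q. sublinear q}. \<forall>q\<in>{q. sublinear q}. q \<le> m \<longrightarrow> q = m"
  proof (rule predicate_Zorn)
    show "partial_order_on {q. sublinear q} (relation_of (\<lambda>p q. q \<le> p) {q. sublinear q})"
      by (auto simp: partial_order_on_def preorder_on_def refl_on_def trans_def antisym_def relation_of_def)
  next
    fix C assume C: "C \<in> Chains (relation_of (\<lambda>p q. q \<le> p) {q. sublinear q})"
    show "\<exists>p\<in>{q. sublinear q}. \<forall>q\<in>C. p \<le> q"
      using sublinear_chain_lower_bound[of C] C by (auto simp: Chains_def relation_of_def)
  qed
  then obtain q where q: "sublinear q" and min: "\<And>p. \<lbrakk>sublinear p; p \<le> q\<rbrakk> \<Longrightarrow> p = q" by blast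
  have add: "q (x \<otimes> y) = q x + q y" if [simp]: "x \<in> carrier M" "y \<in> carrier M" for x y
  proof -
    have "linearise q y z \<le> q z" for z
      using linearise_le[OF q, of y z] by (cases "z \<in> carrier M") (auto simp: linearise_def sublinearD(5)[OF q])
    then have "linearise q y = q"
      by (intro min sublinear_linearise q) (auto simp: le_fun_def)
    \<comment> \<open>The term n = 1 of the infimum already gives superadditivity.\<close>
    then have "q x \<le> q (x \<otimes> y) - q y"
      using linearise_le_term[OF q, of y x 1] by simp
    then show ?thesis using sublinearD(1)[OF q, of x y] by simp
  qed
  have "q u = 1" using sublinearD(4)[OF q, of \<one>] sublinear_one[OF q] by simp
  with that[of q] show ?thesis using add sublinear_nonneg[OF q] sublinearD(3)[OF q] by blast
qed

end

section \<open>Strict comparison by states normalised at an arbitrary element\<close>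

context preordered_monoid
begin

text \<open>The part of the monoid on which \<open>b\<close> acts as an order unit; states
  normalised at \<open>b\<close> are built here and set to infinity outside.\<close>

definition order_ideal :: "'a \<Rightarrow> 'a set" where
  "order_ideal b = {x \<in> carrier M. \<exists>n::nat. x \<lesssim> b [^] n}"

text \<open>The equivalence, rather than closure alone, makes the extension by infinity additive: a
  sum lies outside as soon as one summand does.\<close>

lemma order_ideal_mult_iff:
  assumes [simp]: "b \<in> carrier M" "x \<in> carrier M" "y \<in> carrier M"
  shows "x \<otimes> y \<in> order_ideal b \<longleftrightarrow> x \<in> order_ideal b \<and> y \<in> order_ideal b"
proof
  assume "x \<in> order_ideal b \<and> y \<in> order_ideal b"
  then obtain m n :: nat where "x \<lesssim> b [^] m" "y \<lesssim> b [^] n"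
    unfolding order_ideal_def by blast
  then have "x \<otimes> y \<lesssim> b [^] (m + n)"
    using le_mult[of x "b [^] m" y "b [^] n"] by (simp add: nat_pow_mult)
  then show "x \<otimes> y \<in> order_ideal b" unfolding order_ideal_def by auto
next
  assume "x \<otimes> y \<in> order_ideal b"
  then obtain n :: nat where "x \<otimes> y \<lesssim> b [^] n" unfolding order_ideal_def by blast
  then show "x \<in> order_ideal b \<and> y \<in> order_ideal b"
    using le_multD1[of x y "b [^] n"] le_multD1[of y x "b [^] n"]
    unfolding order_ideal_def by (auto simp: m_comm)
qed

lemma order_ideal_downward:
  assumes "b \<in> carrier M" "x \<in> carrier M" "y \<in> order_ideal b" "x \<lesssim> y"
  shows "x \<in> order_ideal b"
  using assms le_trans[of x y] unfolding order_ideal_def by blast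

text \<open>Under \<open>x \<le>' y \<longleftrightarrow> (\<exists>k. x + k a \<le> y + k b)\<close> one has \<open>b \<le>' a\<close>, so a state for \<open>\<le>'\<close> that is
  normalised at \<open>b\<close> takes a value \<open>\<ge> 1\<close> at \<open>a\<close>. It exists unless \<open>b\<close> is unstable for \<open>\<le>'\<close>, which
  unravels to \<open>(k + 1) a \<le> k b\<close> for some \<open>k\<close>.\<close>

theorem states_strict_comparison:
  assumes a [simp]: "a \<in> carrier M" and b [simp]: "b \<in> carrier M" and ab: "a \<in> order_ideal b"
    and states: "\<And>l :: 'a \<Rightarrow> ennreal.
      \<lbrakk>\<And>x y. \<lbrakk>x \<in> carrier M; y \<in> carrier M\<rbrakk> \<Longrightarrow> l (x \<otimes> y) = l x + l y; l \<one> = 0;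
       \<And>x y. \<lbrakk>x \<in> carrier M; y \<in> carrier M; x \<lesssim> y\<rbrakk> \<Longrightarrow> l x \<le> l y; l b = 1\<rbrakk> \<Longrightarrow> l a < 1"
  shows "\<exists>k::nat. a [^] Suc k \<lesssim> b [^] k"
proof (rule ccontr)
  assume contra: "\<nexists>k::nat. a [^] Suc k \<lesssim> b [^] k"
  obtain n :: nat where an: "a \<lesssim> b [^] n" using ab unfolding order_ideal_def by blast
  define I where "I = order_ideal b"
  have I_sub: "x \<in> I \<Longrightarrow> x \<in> carrier M" for x by (simp add: I_def order_ideal_def)
  have pow_I: "b [^] k \<in> I" for k :: nat
    unfolding I_def order_ideal_def using le_refl[of "b [^] k"] by auto
  define N where "N = M\<lparr>carrier := I\<rparr>"
  have N_simps [simp]: "carrier N = I" "mult N = mult M" "one N = one M" by (simp_all add: N_def)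
  have N_pow [simp]: "x [^]\<^bsub>N\<^esub> (k::nat) = x [^] k" for x k
    unfolding N_def by (rule nat_pow_consistent[symmetric])
  define le' where "le' x y \<longleftrightarrow> (\<exists>k::nat. x \<otimes> a [^] k \<lesssim> y \<otimes> b [^] k)" for x y
  have le_le': "le' x y" if "x \<in> I" "y \<in> I" "x \<lesssim> y" for x y
    unfolding le'_def using that I_sub by (intro exI[of _ 0]) auto
  interpret N: comm_monoid N
    by (rule comm_monoidI)
      (use I_sub pow_I[of 0] in \<open>auto simp: I_def order_ideal_mult_iff m_ac\<close>)
  \<comment> \<open>This is instability of \<open>b\<close> for \<open>le'\<close>. With k b as
    catalyst the assumed inequality can be used j times, giving j b + l j a <= (k + l j) b. As j = n
    (k + 1), the multiple j b dominates (k + 1) a, so (k + l j + 1) a <= (k + l j) b, against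
    \<open>contra\<close>.\<close>
  have no_collapse: False if "b [^] Suc k \<otimes> a [^] l \<lesssim> b [^] k \<otimes> b [^] l" for k l :: nat
  proof -
    define j where "j = n * Suc k"
    have "(b [^] k \<otimes> (b \<otimes> a [^] l)) \<lesssim> b [^] k \<otimes> b [^] l" using that by (simp add: m_ac)
    then have "b [^] k \<otimes> (b \<otimes> a [^] l) [^] j \<lesssim> b [^] k \<otimes> (b [^] l) [^] j"
      by (intro absorb_pow) auto
    then have "b [^] j \<otimes> a [^] (l * j) \<otimes> b [^] k \<lesssim> b [^] (k + l * j)"
      by (simp add: nat_pow_distrib nat_pow_pow nat_pow_mult[symmetric] m_ac)
    then have 1: "b [^] j \<otimes> a [^] (l * j) \<lesssim> b [^] (k + l * j)"
      by (intro le_multD1[of "b [^] j \<otimes> a [^] (l * j)" "b [^] k"]) auto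
    have "a [^] Suc k \<lesssim> (b [^] n) [^] Suc k" by (intro pow_le_pow an) auto
    also have "(b [^] n) [^] Suc k = b [^] j" unfolding j_def by (rule nat_pow_pow) simp
    finally have "a [^] Suc k \<otimes> a [^] (l * j) \<lesssim> b [^] j \<otimes> a [^] (l * j)"
      by (intro le_mult_right) auto
    with 1 have "a [^] Suc k \<otimes> a [^] (l * j) \<lesssim> b [^] (k + l * j)"
      by (intro le_trans[of "a [^] Suc k \<otimes> a [^] (l * j)" _ "b [^] (k + l * j)"]) auto
    moreover have "a [^] Suc k \<otimes> a [^] (l * j) = a [^] Suc (k + l * j)"
      using nat_pow_mult[of a "Suc k" "l * j"] by simp
    ultimately show False using contra by metis
  qed
  interpret N: order_unit_monoid N le' b
  proof
    fix x y z assume "x \<in> carrier N" "y \<in> carrier N" "z \<in> carrier N" and le: "le' x y" "le' y z"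
    then have [simp]: "x \<in> carrier M" "y \<in> carrier M" "z \<in> carrier M" using I_sub by auto
    obtain k l :: nat where kl: "x \<otimes> a [^] k \<lesssim> y \<otimes> b [^] k" "y \<otimes> a [^] l \<lesssim> z \<otimes> b [^] l"
      using le unfolding le'_def by blast
    have "(x \<otimes> a [^] k) \<otimes> a [^] l \<lesssim> (y \<otimes> b [^] k) \<otimes> a [^] l"
      using kl by (intro le_mult_right) auto
    moreover have "(y \<otimes> a [^] l) \<otimes> b [^] k \<lesssim> (z \<otimes> b [^] l) \<otimes> b [^] k"
      using kl by (intro le_mult_right) auto
    moreover have "(y \<otimes> b [^] k) \<otimes> a [^] l = (y \<otimes> a [^] l) \<otimes> b [^] k" by (simp add: m_ac)
    ultimately have "(x \<otimes> a [^] k) \<otimes> a [^] l \<lesssim> (z \<otimes> b [^] l) \<otimes> b [^] k"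
      using le_trans[of "(x \<otimes> a [^] k) \<otimes> a [^] l" "(y \<otimes> a [^] l) \<otimes> b [^] k"] by simp
    then have "x \<otimes> a [^] (k + l) \<lesssim> z \<otimes> b [^] (k + l)"
      by (simp add: nat_pow_mult[symmetric] m_ac)
    then show "le' x z" unfolding le'_def by blast
  next
    fix x y z assume "x \<in> carrier N" "y \<in> carrier N" "z \<in> carrier N" and le: "le' x y"
    then have [simp]: "x \<in> carrier M" "y \<in> carrier M" "z \<in> carrier M" using I_sub by auto
    obtain k :: nat where "x \<otimes> a [^] k \<lesssim> y \<otimes> b [^] k" using le unfolding le'_def by blast
    then have "(x \<otimes> a [^] k) \<otimes> z \<lesssim> (y \<otimes> b [^] k) \<otimes> z" by (intro le_mult_right) auto
    then have "(x \<otimes> z) \<otimes> a [^] k \<lesssim> (y \<otimes> z) \<otimes> b [^] k" by (simp add: m_ac)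
    then show "le' (x \<otimes>\<^bsub>N\<^esub> z) (y \<otimes>\<^bsub>N\<^esub> z)" unfolding le'_def by auto
  next
    fix x assume x: "x \<in> carrier N"
    then show "le' x x" using I_sub le_refl by (intro le_le') auto
    show "le' \<one>\<^bsub>N\<^esub> x" using x I_sub one_le pow_I[of 0] by (intro le_le') auto
    from x obtain m :: nat where "x \<lesssim> b [^] m" unfolding N_simps I_def order_ideal_def by blast
    then show "\<exists>m::nat. le' x (b [^]\<^bsub>N\<^esub> m)" using x pow_I by (auto intro!: exI[of _ m] le_le')
  next
    show "b \<in> carrier N" using pow_I[of 1] by simp
  next
    fix k show "\<not> le' (b [^]\<^bsub>N\<^esub> Suc k) (b [^]\<^bsub>N\<^esub> k)"
      unfolding le'_def N_pow using no_collapse by blast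
  qed
  obtain q :: "'a \<Rightarrow> real" where q: "\<And>x. x \<in> I \<Longrightarrow> 0 \<le> q x"
    "\<And>x y. \<lbrakk>x \<in> I; y \<in> I\<rbrakk> \<Longrightarrow> q (x \<otimes> y) = q x + q y"
    "\<And>x y. \<lbrakk>x \<in> I; y \<in> I; le' x y\<rbrakk> \<Longrightarrow> q x \<le> q y" "q b = 1"
    using N.state_exists unfolding N_simps by blast
  have aI: "a \<in> I" and bI: "b \<in> I" using ab pow_I[of 1] by (auto simp: I_def)
  \<comment> \<open>Infinity outside the ideal preserves additivity by
    \<open>order_ideal_mult_iff\<close> and monotonicity by
    \<open>order_ideal_downward\<close>.\<close>
  define l where "l x = (if x \<in> I then ennreal (q x) else \<infinity>)" for x
  have "l a < 1"
  proof (rule states)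
    fix x y assume "x \<in> carrier M" "y \<in> carrier M"
    then show "l (x \<otimes> y) = l x + l y"
      unfolding l_def using q(1,2) order_ideal_mult_iff[of b x y] by (auto simp: I_def)
  next
    show "l \<one> = 0" unfolding l_def using q(2)[of \<one> \<one>] pow_I[of 0] by simp
  next
    fix x y assume xy: "x \<in> carrier M" "y \<in> carrier M" "x \<lesssim> y"
    then show "l x \<le> l y"
      unfolding l_def using q(3)[of x y] le_le'[of x y] order_ideal_downward[of b x y]
      by (auto simp: I_def intro: ennreal_leI)
  next
    show "l b = 1" unfolding l_def using bI q(4) by simp
  qed
  \<comment> \<open>With k = 1 both sides equal a + b.\<close>
  moreover have "le' b a"
    unfolding le'_def using le_refl[of "a \<otimes> b"] by (intro exI[of _ 1]) (simp add: m_comm)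
  then have "1 \<le> q a" using q(3)[OF bI aI] q(4) by simp
  then have "1 \<le> l a" unfolding l_def using aI by simp
  ultimately show False by simp
qed

end

section \<open>W-semigroups and their completions\<close>

context W_semigroup
begin

lemma belowI: "\<lbrakk>b \<in> carrier S; b \<prec> a\<rbrakk> \<Longrightarrow> b \<in> below S a"
  by (simp add: below_def)

lemma belowD: "b \<in> below S a \<Longrightarrow> b \<in> carrier S" "b \<in> below S a \<Longrightarrow> b \<prec> a"
  by (simp_all add: below_def)

lemma below_trans: "\<lbrakk>a \<in> carrier S; b \<in> below S a; c \<in> below S b\<rbrakk> \<Longrightarrow> c \<in> below S a"
  by (auto simp: below_def intro: prec_trans)

lemma one_below: "a \<in> carrier S \<Longrightarrow> \<one> \<in> below S a"
  by (simp add: below_def zero_prec)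

lemma below_mult:
  "\<lbrakk>a \<in> carrier S; b \<in> carrier S; a' \<in> below S a; b' \<in> below S b\<rbrakk> \<Longrightarrow> a' \<otimes> b' \<in> below S (a \<otimes> b)"
  using W3 by (auto simp: below_def)

lemma le_prec_below: "\<lbrakk>a \<in> carrier S; b \<in> below S a\<rbrakk> \<Longrightarrow> le_prec S b a"
  unfolding le_prec_def using below_trans by blast

lemma below_multE:
  assumes "a \<in> carrier S" "b \<in> carrier S" "c \<in> below S (a \<otimes> b)"
  obtains a' b' where "a' \<in> below S a" "b' \<in> below S b" "c \<in> below S (a' \<otimes> b')"
  using W4[of c a b] assms unfolding below_def by blast

text \<open>Each of the two elements is below some term of the cofinal sequence from
  \<open>W1\<close>; the index i + j is late enough for both.\<close>

lemma below_directed: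
  assumes a: "a \<in> carrier S" and "b \<in> below S a" "c \<in> below S a"
  obtains d where "d \<in> below S a" "b \<in> below S d" "c \<in> below S d"
proof -
  obtain s :: "nat \<Rightarrow> 'a" where s: "\<And>k. s k \<in> below S a" "\<And>k. s k \<prec> s (Suc k)"
    "\<And>b. b \<in> below S a \<Longrightarrow> \<exists>k. b \<prec> s k"
    using W1[OF a] by blast
  obtain i j where ij: "b \<prec> s i" "c \<prec> s j" using s(3) assms by blast
  have mono: "x \<prec> s (i + k)" if "x \<in> carrier S" "x \<prec> s i" for x i k
  proof (induct k)
    case (Suc k)
    then show ?case
      using that(1) s(2)[of "i + k"] belowD(1)[OF s(1)] prec_trans[of x "s (i + k)" "s (Suc (i + k))"] by simp
  qed (use that in simp)
  have "b \<prec> s (i + j)" "c \<prec> s (j + i)"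
    using assms ij belowD by (auto intro!: mono)
  then show ?thesis using that[of "s (i + j)"] s(1) assms by (auto simp: below_def add.commute)
qed

lemma below_interpolate:
  assumes "a \<in> carrier S" "b \<in> below S a"
  obtains d where "d \<in> below S a" "b \<in> below S d"
  using below_directed[OF assms assms(2)] by blast

lemma below_pow: "\<lbrakk>a \<in> carrier S; b \<in> below S a\<rbrakk> \<Longrightarrow> b [^] (n::nat) \<in> below S (a [^] n)"
  by (induct n) (auto intro: one_below below_mult)

text \<open>Iterating \<open>W4\<close> yields a different element below \<open>b\<close> for each
  summand; directedness replaces them by a single one.\<close>

lemma below_powE:
  assumes "b \<in> carrier S" "a \<in> below S (b [^] (n::nat))"
  obtains b' where "b' \<in> below S b" "a \<in> below S (b' [^] n)"
proof -
  have "\<exists>b'\<in>below S b. a \<in> below S (b' [^] n)" using assms(2)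
  proof (induct n arbitrary: a)
    case 0
    then show ?case using one_below[OF assms(1)] by auto
  next
    case (Suc n)
    then have "a \<in> carrier S" "a \<prec> b [^] n \<otimes> b" using belowD by auto
    then obtain c b1 where c: "c \<in> below S (b [^] n)" and b1: "b1 \<in> below S b" and a: "a \<prec> c \<otimes> b1"
      using W4[of a "b [^] n" b] assms(1) by auto
    obtain b2 where b2: "b2 \<in> below S b" "c \<in> below S (b2 [^] n)" using Suc.hyps[OF c] by blast
    obtain b3 where b3: "b3 \<in> below S b" "b1 \<in> below S b3" "b2 \<in> below S b3"
      using below_directed[OF assms(1) b1 b2(1)] by blast
    have [simp]: "b3 \<in> carrier S" using b3 belowD by blast
    have "c \<in> below S (b3 [^] n)"
      using below_trans[OF _ below_pow[of b3 b2 n]] b2 b3 by auto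
    then have "c \<otimes> b1 \<in> below S (b3 [^] n \<otimes> b3)" using b3 by (intro below_mult) auto
    then have "a \<in> below S (b3 [^] n \<otimes> b3)"
      by (rule below_trans[rotated]) (use a \<open>a \<in> carrier S\<close> in \<open>auto intro: belowI\<close>)
    then show ?case using b3 by auto
  qed
  then show ?thesis using that by blast
qed

end

text \<open>Compatibility makes all sets in the union of \<open>class_op\<close> the same class, so
  both quotients can be computed on representatives.\<close>

lemma class_op_classes:
  assumes r: "equiv A r" and f: "\<And>x y. \<lbrakk>x \<in> A; y \<in> A\<rbrakk> \<Longrightarrow> f x y \<in> A"
    and cong: "\<And>x x' y y'. \<lbrakk>(x, x') \<in> r; (y, y') \<in> r\<rbrakk> \<Longrightarrow> (f x y, f x' y') \<in> r"
    and xy: "x \<in> A" "y \<in> A"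
  shows "class_op r f (r `` {x}) (r `` {y}) = r `` {f x y}"
proof -
  have "r `` {f x' y'} = r `` {f x y}" if "x' \<in> r `` {x}" "y' \<in> r `` {y}" for x' y'
    using that cong equiv_class_eq[OF r] by (metis Image_singleton_iff)
  moreover have "x \<in> r `` {x}" "y \<in> r `` {y}" using r xy by (auto dest: equiv_class_self)
  ultimately show ?thesis unfolding class_op_def by blast
qed

lemma equiv_antisym_rel:
  assumes "\<And>x. x \<in> A \<Longrightarrow> R x x" "\<And>x y z. \<lbrakk>x \<in> A; y \<in> A; z \<in> A; R x y; R y z\<rbrakk> \<Longrightarrow> R x z"
  shows "equiv A (antisym_rel A R)"
  unfolding equiv_def refl_on_def sym_def trans_def antisym_rel_def using assms by blast

section \<open>The completion by increasing sequences\<close>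

context W_semigroup
begin

abbreviation "incr \<equiv> prec_increasing S"
abbreviation "gamma_class s \<equiv> antisym_rel incr (precsim S) `` {s}"

lemma incrD: "s \<in> incr \<Longrightarrow> s n \<in> carrier S" "s \<in> incr \<Longrightarrow> s n \<prec> s (Suc n)"
  by (auto simp: prec_increasing_def)

lemma incr_below: "s \<in> incr \<Longrightarrow> s n \<in> below S (s (Suc n))"
  by (auto simp: prec_increasing_def below_def)

lemma incr_shift:
  assumes s: "s \<in> incr" and "x \<in> carrier S" "x \<prec> s n" "n \<le> m"
  shows "x \<prec> s m"
  using assms(4)
proof (induct rule: dec_induct)
  case (step m)
  then show ?case using assms(2) incrD[OF s] prec_trans[of x "s m" "s (Suc m)"] by blast
qed (rule assms(3))

lemma precsim_refl: "s \<in> incr \<Longrightarrow> precsim S s s"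
  unfolding precsim_def using incrD by blast

lemma precsim_trans:
  "\<lbrakk>s \<in> incr; t \<in> incr; w \<in> incr; precsim S s t; precsim S t w\<rbrakk> \<Longrightarrow> precsim S s w"
  unfolding precsim_def by (meson incrD(1) prec_trans)

lemma incr_mult: "\<lbrakk>s \<in> incr; t \<in> incr\<rbrakk> \<Longrightarrow> (\<lambda>n. s n \<otimes> t n) \<in> incr"
  unfolding prec_increasing_def by (auto intro!: W3 belowI)

lemma precsim_mult:
  assumes "s \<in> incr" "t \<in> incr" "s' \<in> incr" "t' \<in> incr" "precsim S s s'" "precsim S t t'"
  shows "precsim S (\<lambda>n. s n \<otimes> t n) (\<lambda>n. s' n \<otimes> t' n)"
  unfolding precsim_def
proof
  fix n
  obtain i j where "s n \<prec> s' i" "t n \<prec> t' j" using assms unfolding precsim_def by blast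
  then have "s n \<prec> s' (max i j)" "t n \<prec> t' (max i j)"
    using assms by (auto intro: incr_shift incrD)
  then show "\<exists>m. s n \<otimes> t n \<prec> s' m \<otimes> t' m"
    using assms by (intro exI[of _ "max i j"] W3) (auto simp: below_def incrD)
qed

lemma incr_pow: "s \<in> incr \<Longrightarrow> (\<lambda>n. s n [^] (k::nat)) \<in> incr"
proof (induct k)
  case 0
  then show ?case by (simp add: prec_increasing_def zero_prec)
next
  case (Suc k)
  then show ?case using incr_mult[of "\<lambda>n. s n [^] k" s] by simp
qed

lemma equiv_gamma: "equiv incr (antisym_rel incr (precsim S))"
  using precsim_refl precsim_trans by (rule equiv_antisym_rel)

lemma gamma_mult:
  assumes "s \<in> incr" "t \<in> incr"
  shows "gamma_class s \<otimes>\<^bsub>gamma_W S\<^esub> gamma_class t = gamma_class (\<lambda>n. s n \<otimes> t n)"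
proof -
  have "class_op (antisym_rel incr (precsim S)) (\<lambda>s t n. s n \<otimes> t n) (gamma_class s) (gamma_class t)
      = gamma_class (\<lambda>n. s n \<otimes> t n)"
    using assms by (intro class_op_classes[OF equiv_gamma])
      (auto simp: antisym_rel_def intro: incr_mult precsim_mult)
  then show ?thesis by (simp add: gamma_W_def Let_def)
qed

lemma gamma_pow:
  assumes "s \<in> incr"
  shows "gamma_class s [^]\<^bsub>gamma_W S\<^esub> (k::nat) = gamma_class (\<lambda>n. s n [^] k)"
proof (induct k)
  case 0
  then show ?case by (simp add: gamma_W_def Let_def)
next
  case (Suc k)
  then show ?case using gamma_mult[OF incr_pow[OF assms] assms, of k] by simp
qed

lemma gamma_le:
  assumes "s \<in> incr" "t \<in> incr"
  shows "ord_le (gamma_W S) (gamma_class s) (gamma_class t) \<longleftrightarrow> precsim S s t"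
proof
  assume "ord_le (gamma_W S) (gamma_class s) (gamma_class t)"
  then obtain s' t' where "s' \<in> gamma_class s" "t' \<in> gamma_class t" "precsim S s' t'"
    by (auto simp: gamma_W_def Let_def)
  then show "precsim S s t"
    by (auto simp: antisym_rel_def intro: precsim_trans)
next
  assume "precsim S s t"
  moreover have "s \<in> gamma_class s" "t \<in> gamma_class t" using equiv_class_self[OF equiv_gamma] assms by auto
  ultimately show "ord_le (gamma_W S) (gamma_class s) (gamma_class t)"
    by (auto simp: gamma_W_def Let_def)
qed

lemma almost_unperforated_gamma_iff:
  "almost_unperforated_Cu (gamma_W S) \<longleftrightarrow>
    (\<forall>s\<in>incr. \<forall>t\<in>incr. (\<exists>k::nat. precsim S (\<lambda>n. s n [^] (k + 1)) (\<lambda>n. t n [^] k)) \<longrightarrow> precsim S s t)"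
proof -
  have carrier: "carrier (gamma_W S) = gamma_class ` incr" by (auto simp: gamma_W_def Let_def quotient_def)
  have pow: "ord_le (gamma_W S) (gamma_class s [^]\<^bsub>gamma_W S\<^esub> (k + 1)) (gamma_class t [^]\<^bsub>gamma_W S\<^esub> k)
      \<longleftrightarrow> precsim S (\<lambda>n. s n [^] (k + 1)) (\<lambda>n. t n [^] k)"
    if "s \<in> incr" "t \<in> incr" for s t and k :: nat
    unfolding gamma_pow[OF that(1)] gamma_pow[OF that(2)] using that by (intro gamma_le incr_pow)
  show ?thesis
    unfolding almost_unperforated_Cu_def carrier by (simp only: ball_simps pow gamma_le cong: ball_cong)
qed

theorem almost_unperforated_W_iff_gamma:
  "almost_unperforated_W S \<longleftrightarrow> almost_unperforated_Cu (gamma_W S)"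
proof
  assume W: "almost_unperforated_W S"
  show "almost_unperforated_Cu (gamma_W S)"
    unfolding almost_unperforated_gamma_iff
  proof (intro ballI impI)
    fix s t assume s: "s \<in> incr" and t: "t \<in> incr"
      and "\<exists>k::nat. precsim S (\<lambda>n. s n [^] (k + 1)) (\<lambda>n. t n [^] k)"
    then obtain k :: nat where k: "\<And>n. \<exists>m. s n [^] (k + 1) \<prec> t m [^] k"
      unfolding precsim_def by blast
    have "\<exists>m. s n \<prec> t m" for n
    proof -
      \<comment> \<open>The index is n + 1 because almost unperforation only yields
        \<open>le_prec\<close>; \<open>s n\<close> lies strictly below that term and so below
        \<open>t m\<close>.\<close>
      obtain m where "s (Suc n) [^] (k + 1) \<prec> t m [^] k" using k by blast
      then have "le_prec S (s (Suc n)) (t m)"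
        using W s t incrD(1) unfolding almost_unperforated_W_def by blast
      then show ?thesis using incr_below[OF s] by (auto simp: le_prec_def below_def)
    qed
    then show "precsim S s t" unfolding precsim_def by blast
  qed
next
  assume Cu: "almost_unperforated_Cu (gamma_W S)"
  show "almost_unperforated_W S"
    unfolding almost_unperforated_W_def
  proof (intro ballI impI)
    fix a b assume a: "a \<in> carrier S" and b: "b \<in> carrier S"
      and "\<exists>k::nat. a [^] (k + 1) \<prec> b [^] k"
    then obtain k :: nat where k: "a [^] (k + 1) \<prec> b [^] k" by blast
    \<comment> \<open>The elements \<open>a\<close> and \<open>b\<close> are replaced by cofinal
      sequences below them, to which the hypothesis on the completion applies.\<close>
    obtain s :: "nat \<Rightarrow> 'a" where s: "\<And>k. s k \<in> below S a" "\<And>k. s k \<prec> s (Suc k)"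
      "\<And>c. c \<in> below S a \<Longrightarrow> \<exists>k. c \<prec> s k" using W1[OF a] by blast
    obtain t :: "nat \<Rightarrow> 'a" where t: "\<And>k. t k \<in> below S b" "\<And>k. t k \<prec> t (Suc k)"
      "\<And>c. c \<in> below S b \<Longrightarrow> \<exists>k. c \<prec> t k" using W1[OF b] by blast
    have st: "s \<in> incr" "t \<in> incr" using s t by (auto simp: prec_increasing_def below_def)
    have "precsim S (\<lambda>n. s n [^] (k + 1)) (\<lambda>n. t n [^] k)"
      unfolding precsim_def
    proof
      fix n
      have "a [^] (k + 1) \<in> below S (b [^] k)" by (rule belowI[OF nat_pow_closed[OF a] k])
      then have "s n [^] (k + 1) \<in> below S (b [^] k)"
        by (rule below_trans[OF nat_pow_closed[OF b] _ below_pow[OF a s(1)]])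
      \<comment> \<open>\<open>below_powE\<close> moves \<open>b\<close> down to one element
        \<open>b'\<close>, which cofinality puts below a single term \<open>t m\<close>.\<close>
      then obtain b' where b': "b' \<in> below S b" "s n [^] (k + 1) \<in> below S (b' [^] k)"
        using below_powE[OF b] by blast
      then obtain m where "b' \<prec> t m" using t by blast
      then have "b' \<in> below S (t m)" using b' by (simp add: below_def)
      then have "b' [^] k \<in> below S (t m [^] k)" using incrD[OF st(2)] by (intro below_pow)
      then have "s n [^] (k + 1) \<in> below S (t m [^] k)"
        by (rule below_trans[OF nat_pow_closed[OF incrD(1)[OF st(2)]] _ b'(2)])
      then show "\<exists>m. s n [^] (k + 1) \<prec> t m [^] k" using belowD by blast
    qed
    then have "precsim S s t" using Cu st unfolding almost_unperforated_gamma_iff by blast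
    show "le_prec S a b"
      unfolding le_prec_def
    proof
      fix c assume c: "c \<in> below S a"
      then obtain n where "c \<prec> s n" using s(3) by blast
      moreover obtain m where "s n \<prec> t m" using \<open>precsim S s t\<close> unfolding precsim_def by blast
      ultimately have "c \<prec> t m"
        using c belowD incrD(1) st prec_trans[of c "s n" "t m"] by blast
      then show "c \<in> below S b"
        using c b t(1) below_trans[of b "t m" c] by (simp add: below_def)
    qed
  qed
qed

end

section \<open>The quotient by the group action\<close>

context GW_semigroup
begin

lemma group_G: "group G"
  using group_hom by (rule group_hom.axioms)

lemma act_closed [simp]: "\<lbrakk>g \<in> carrier G; x \<in> carrier S\<rbrakk> \<Longrightarrow> \<phi> g x \<in> carrier S"
  using element_image by blast

lemma inv_closed [simp]: "g \<in> carrier G \<Longrightarrow> inv\<^bsub>G\<^esub> g \<in> carrier G"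
  by (rule group.inv_closed[OF group_G])

lemma act_inv_act: "\<lbrakk>g \<in> carrier G; x \<in> carrier S\<rbrakk> \<Longrightarrow> \<phi> (inv\<^bsub>G\<^esub> g) (\<phi> g x) = x"
  using orbit_sym_aux by blast

lemma act_act_inv: "\<lbrakk>g \<in> carrier G; x \<in> carrier S\<rbrakk> \<Longrightarrow> \<phi> g (\<phi> (inv\<^bsub>G\<^esub> g) x) = x"
  using act_inv_act[of "inv\<^bsub>G\<^esub> g" x] group.inv_inv[OF group_G] by simp

lemma act_group_one: "x \<in> carrier S \<Longrightarrow> \<phi> \<one>\<^bsub>G\<^esub> x = x"
  using id_eq_one by (metis restrict_apply')

text \<open>Surjectivity of the translation is combined with additivity: with g x = 0, one has g 0 =
  g 0 + g x = g (0 + x) = g x = 0.\<close>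

lemma act_one: assumes g: "g \<in> carrier G" shows "\<phi> g \<one>\<^bsub>S\<^esub> = \<one>\<^bsub>S\<^esub>"
proof -
  define x where "x = \<phi> (inv\<^bsub>G\<^esub> g) \<one>\<^bsub>S\<^esub>"
  have x: "x \<in> carrier S" using g by (simp add: x_def)
  have "\<phi> g (\<one>\<^bsub>S\<^esub> \<otimes>\<^bsub>S\<^esub> x) = \<phi> g \<one>\<^bsub>S\<^esub> \<otimes>\<^bsub>S\<^esub> \<phi> g x"
    using action_add[OF g one_closed x] .
  then show ?thesis using g x act_act_inv[OF g one_closed] by (simp add: x_def)
qed

lemma act_below: "\<lbrakk>g \<in> carrier G; a \<in> carrier S; b \<in> below S a\<rbrakk> \<Longrightarrow> \<phi> g b \<in> below S (\<phi> g a)"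
  using action_prec by (auto simp: below_def)

lemma act_below_inv:
  "\<lbrakk>g \<in> carrier G; a \<in> carrier S; b \<in> below S (\<phi> g a)\<rbrakk> \<Longrightarrow> \<phi> (inv\<^bsub>G\<^esub> g) b \<in> below S a"
  using act_below[of "inv\<^bsub>G\<^esub> g" "\<phi> g a" b] by (simp add: act_inv_act)

abbreviation leG (infix "\<lesssim>" 50) where
  "x \<lesssim> y \<equiv> le_G G S \<phi> x y"

lemma leG_carrier: "a \<lesssim> b \<Longrightarrow> a \<in> carrier S \<and> b \<in> carrier S"
  by (induct rule: le_G.induct) auto

lemma leG_belowI: "\<lbrakk>a \<in> carrier S; b \<in> below S a\<rbrakk> \<Longrightarrow> b \<lesssim> a"
  using le_prec_below[of a b] belowD[of b a] by (intro le_G_prec) auto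

lemma leG_mult: "\<lbrakk>a \<lesssim> b; c \<lesssim> d\<rbrakk> \<Longrightarrow> a \<otimes>\<^bsub>S\<^esub> c \<lesssim> b \<otimes>\<^bsub>S\<^esub> d"
  by (rule le_G_add[OF _ _ refl refl])

text \<open>Induction on the generation of \<open>\<le>\<^sub>G\<close>. Inverse group elements
  handle the action clause, interpolation the approximation clause, and \<open>W4\<close> the
  additive clause.\<close>

lemma leG_belowE:
  assumes "a \<lesssim> b" "c \<in> below S a"
  obtains d where "d \<in> below S b" "c \<lesssim> d"
proof -
  have "\<exists>d\<in>below S b. c \<lesssim> d" using assms
  proof (induct arbitrary: c rule: le_G.induct)
    case (le_G_refl a)
    then show ?case using le_G.le_G_refl[OF belowD(1)] by blast
  next
    case (le_G_trans a b d)
    then obtain e where "e \<in> below S b" "c \<lesssim> e" by blast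
    moreover from this obtain f where "f \<in> below S d" "e \<lesssim> f" using le_G_trans by blast
    ultimately show ?case using le_G.le_G_trans[of G S \<phi> c e f] by blast
  next
    case (le_G_prec a b)
    then show ?case unfolding le_prec_def using le_G.le_G_refl[OF belowD(1)] by blast
  next
    case (le_G_action b g a)
    have c: "\<phi> g (\<phi> (inv\<^bsub>G\<^esub> g) c) = c"
      using le_G_action belowD by (intro act_act_inv) auto
    have d: "\<phi> (inv\<^bsub>G\<^esub> g) c \<in> below S b"
      using le_G_action by (intro act_below_inv) auto
    then have "c \<lesssim> \<phi> (inv\<^bsub>G\<^esub> g) c"
      using le_G_action(2) c belowD(1)[OF d] by (intro le_G.le_G_action) auto
    then show ?case using d by blast
  next
    case (le_G_approx a b)
    \<comment> \<open>The induction hypothesis treats elements strictly below a member of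
      \<open>below S a\<close>, so an intermediate \<open>d\<close> is inserted.\<close>
    then obtain d where "d \<in> below S a" "c \<in> below S d" using below_interpolate by blast
    then show ?case using le_G_approx(3) by blast
  next
    case (le_G_add a1 b1 a2 b2 a b)
    have car: "a1 \<in> carrier S" "b1 \<in> carrier S" "a2 \<in> carrier S" "b2 \<in> carrier S"
      using le_G_add leG_carrier by blast+
    then obtain a1' a2' where a': "a1' \<in> below S a1" "a2' \<in> below S a2" "c \<in> below S (a1' \<otimes>\<^bsub>S\<^esub> a2')"
      using le_G_add below_multE by blast
    then obtain d1 d2 where d: "d1 \<in> below S b1" "a1' \<lesssim> d1" "d2 \<in> below S b2" "a2' \<lesssim> d2"
      using le_G_add by blast
    have "c \<lesssim> a1' \<otimes>\<^bsub>S\<^esub> a2'" using a' belowD by (intro leG_belowI) auto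
    moreover have "a1' \<otimes>\<^bsub>S\<^esub> a2' \<lesssim> d1 \<otimes>\<^bsub>S\<^esub> d2" by (rule leG_mult[OF d(2,4)])
    moreover have "d1 \<otimes>\<^bsub>S\<^esub> d2 \<in> below S b"
      using d le_G_add car by (auto intro: below_mult)
    ultimately show ?case using le_G.le_G_trans[of G S \<phi> c] by meson
  qed
  then show ?thesis using that by blast
qed

lemma leG_actI: "\<lbrakk>g \<in> carrier G; a \<in> carrier S\<rbrakk> \<Longrightarrow> \<phi> g a \<lesssim> a"
  by (rule le_G_action) auto

lemma leG_actI': "\<lbrakk>g \<in> carrier G; a \<in> carrier S\<rbrakk> \<Longrightarrow> a \<lesssim> \<phi> g a"
  using leG_actI[of "inv\<^bsub>G\<^esub> g" "\<phi> g a"] by (simp add: act_inv_act)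

sublocale preordered: preordered_monoid S leG
proof
  show "x \<lesssim> x" if "x \<in> carrier S" for x using that by (rule le_G_refl)
  show "x \<lesssim> z" if "x \<lesssim> y" "y \<lesssim> z" for x y z using that by (rule le_G_trans)
  show "x \<otimes>\<^bsub>S\<^esub> z \<lesssim> y \<otimes>\<^bsub>S\<^esub> z" if "z \<in> carrier S" "x \<lesssim> y" for x y z
    by (rule leG_mult[OF that(2) le_G_refl[OF that(1)]])
  show "\<one>\<^bsub>S\<^esub> \<lesssim> x" if "x \<in> carrier S" for x
    using that by (intro leG_belowI one_below)
qed

abbreviation "quot_class a \<equiv> antisym_rel (carrier S) leG `` {a}"

lemma equiv_leG: "equiv (carrier S) (antisym_rel (carrier S) leG)"
  using preordered.le_refl preordered.le_trans by (rule equiv_antisym_rel)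

lemma carrier_quot: "carrier (quot_W G S \<phi>) = quot_class ` carrier S"
  by (auto simp: quot_W_def Let_def quotient_def)

lemma quot_one: "\<one>\<^bsub>quot_W G S \<phi>\<^esub> = quot_class \<one>\<^bsub>S\<^esub>"
  by (simp add: quot_W_def Let_def)

lemma quot_mult:
  assumes "a \<in> carrier S" "b \<in> carrier S"
  shows "quot_class a \<otimes>\<^bsub>quot_W G S \<phi>\<^esub> quot_class b = quot_class (a \<otimes>\<^bsub>S\<^esub> b)"
proof -
  have "class_op (antisym_rel (carrier S) leG) (mult S) (quot_class a) (quot_class b) = quot_class (a \<otimes>\<^bsub>S\<^esub> b)"
    using assms by (intro class_op_classes[OF equiv_leG])
      (auto simp: antisym_rel_def intro: preordered.le_mult)
  then show ?thesis by (simp add: quot_W_def Let_def)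
qed

text \<open>\<open>leG_belowE\<close> transfers \<open>\<prec>\<close> from another representative
  of the class of \<open>b\<close> to \<open>b\<close> itself, so only the left side is left with
  \<open>\<le>\<^sub>G\<close>.\<close>

lemma quot_prec:
  assumes a: "a \<in> carrier S" and b: "b \<in> carrier S"
  shows "quot_class a \<prec>\<^bsub>quot_W G S \<phi>\<^esub> quot_class b \<longleftrightarrow> (\<exists>c\<in>below S b. a \<lesssim> c)"
proof
  assume "quot_class a \<prec>\<^bsub>quot_W G S \<phi>\<^esub> quot_class b"
  then obtain a' b' c where "a \<lesssim> a'" "b' \<lesssim> b" "a' \<lesssim> c" "c \<in> below S b'"
    by (auto simp: quot_W_def Let_def antisym_rel_def below_def)
  then show "\<exists>c\<in>below S b. a \<lesssim> c"
    using leG_belowE[of b' b c] le_G_trans[of G S \<phi> a] by metis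
next
  assume "\<exists>c\<in>below S b. a \<lesssim> c"
  moreover have "a \<in> quot_class a" "b \<in> quot_class b" using equiv_class_self[OF equiv_leG] a b by auto
  ultimately show "quot_class a \<prec>\<^bsub>quot_W G S \<phi>\<^esub> quot_class b"
    by (auto simp: quot_W_def Let_def below_def)
qed

lemma quot_below:
  assumes "a \<in> carrier S"
  shows "below (quot_W G S \<phi>) (quot_class a) = {quot_class b | b c. b \<lesssim> c \<and> c \<in> below S a}"
  using assms quot_prec leG_carrier unfolding below_def[of "quot_W G S \<phi>"] carrier_quot by blast

text \<open>The approximation clause of \<open>\<le>\<^sub>G\<close> recovers
  \<open>a \<lesssim> b\<close> from the elements below \<open>a\<close>; \<open>leG_belowE\<close>
  gives the converse.\<close>

lemma quot_le_prec:
  assumes a: "a \<in> carrier S" and b: "b \<in> carrier S"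
  shows "le_prec (quot_W G S \<phi>) (quot_class a) (quot_class b) \<longleftrightarrow> a \<lesssim> b"
proof
  assume le: "le_prec (quot_W G S \<phi>) (quot_class a) (quot_class b)"
  have "c \<lesssim> b" if c: "c \<in> below S a" for c
  proof -
    have "quot_class c \<in> below (quot_W G S \<phi>) (quot_class a)"
      using c le_G_refl[OF belowD(1)[OF c]] unfolding quot_below[OF a] by blast
    then have "quot_class c \<prec>\<^bsub>quot_W G S \<phi>\<^esub> quot_class b" using le by (auto simp: le_prec_def below_def)
    then obtain d where "d \<in> below S b" "c \<lesssim> d" using quot_prec[OF belowD(1)[OF c] b] by blast
    then show ?thesis using leG_belowI[OF b] le_G_trans[of G S \<phi> c d b] by blast
  qed
  then show "a \<lesssim> b" using a b by (intro le_G_approx) auto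
next
  assume ab: "a \<lesssim> b"
  have "\<exists>e\<in>below S b. c \<lesssim> e" if "c \<lesssim> d" "d \<in> below S a" for c d
    using leG_belowE[OF ab that(2)] le_G_trans[OF that(1)] by metis
  then show "le_prec (quot_W G S \<phi>) (quot_class a) (quot_class b)"
    unfolding le_prec_def quot_below[OF a] quot_below[OF b] by blast
qed

lemma quot_pow: "a \<in> carrier S \<Longrightarrow> quot_class a [^]\<^bsub>quot_W G S \<phi>\<^esub> (n::nat) = quot_class (a [^]\<^bsub>S\<^esub> n)"
  by (induct n) (simp_all add: quot_one quot_mult)

lemma comm_monoid_quot: "comm_monoid (quot_W G S \<phi>)"
  by (rule comm_monoidI) (auto simp: carrier_quot quot_one quot_mult m_ac)

text \<open>Each axiom is checked on representatives, with \<open>leG_belowE\<close> supplying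
  transitivity. This allows the equivalence with the completion to be applied to S/G.\<close>

lemma W_semigroup_quot: "W_semigroup (quot_W G S \<phi>)"
proof -
  interpret Q: comm_monoid "quot_W G S \<phi>" by (rule comm_monoid_quot)
  show ?thesis
  proof
    fix A B C
    assume "A \<in> carrier (quot_W G S \<phi>)" "B \<in> carrier (quot_W G S \<phi>)" "C \<in> carrier (quot_W G S \<phi>)"
      and prec: "A \<prec>\<^bsub>quot_W G S \<phi>\<^esub> B" "B \<prec>\<^bsub>quot_W G S \<phi>\<^esub> C"
    then obtain a b c where abc: "a \<in> carrier S" "b \<in> carrier S" "c \<in> carrier S"
      "A = quot_class a" "B = quot_class b" "C = quot_class c" unfolding carrier_quot by blast
    then obtain a' b' where a': "a \<lesssim> a'" "a' \<in> below S b" and b': "b \<lesssim> b'" "b' \<in> below S c"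
      using prec quot_prec by auto
    obtain d where d: "d \<in> below S b'" "a' \<lesssim> d" using leG_belowE[OF b'(1) a'(2)] by blast
    then have "d \<in> below S c" using b' abc below_trans by blast
    moreover have "a \<lesssim> d" using a'(1) d(2) by (rule le_G_trans)
    ultimately show "A \<prec>\<^bsub>quot_W G S \<phi>\<^esub> C" using abc quot_prec by blast
  next
    fix A assume "A \<in> carrier (quot_W G S \<phi>)"
    then obtain a where "a \<in> carrier S" "A = quot_class a" unfolding carrier_quot by blast
    then show "\<one>\<^bsub>quot_W G S \<phi>\<^esub> \<prec>\<^bsub>quot_W G S \<phi>\<^esub> A"
      using quot_prec[of "\<one>\<^bsub>S\<^esub>" a] one_below le_G_refl[OF one_closed] by (auto simp: quot_one)
  next
    fix A assume "A \<in> carrier (quot_W G S \<phi>)"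
    then obtain a where a: "a \<in> carrier S" "A = quot_class a" unfolding carrier_quot by blast
    obtain s :: "nat \<Rightarrow> _" where s: "\<And>k. s k \<in> below S a" "\<And>k. s k \<prec>\<^bsub>S\<^esub> s (Suc k)"
      "\<And>c. c \<in> below S a \<Longrightarrow> \<exists>k. c \<prec>\<^bsub>S\<^esub> s k" using W1[OF a(1)] by blast
    have s_closed: "s k \<in> carrier S" for k using s(1) belowD by blast
    show "\<exists>t. (\<forall>k. t k \<in> below (quot_W G S \<phi>) A) \<and> (\<forall>k. t k \<prec>\<^bsub>quot_W G S \<phi>\<^esub> t (Suc k)) \<and>
        (\<forall>B\<in>below (quot_W G S \<phi>) A. \<exists>k. B \<prec>\<^bsub>quot_W G S \<phi>\<^esub> t k)"
    proof (intro exI[of _ "\<lambda>k. quot_class (s k)"] conjI allI ballI)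
      show "quot_class (s k) \<in> below (quot_W G S \<phi>) A" for k
        unfolding a(2) quot_below[OF a(1)] using s(1) le_G_refl[OF s_closed] by blast
      show "quot_class (s k) \<prec>\<^bsub>quot_W G S \<phi>\<^esub> quot_class (s (Suc k))" for k
        using quot_prec[OF s_closed s_closed] le_G_refl[OF s_closed] belowI[OF s_closed s(2)] by blast
    next
      fix B assume "B \<in> below (quot_W G S \<phi>) A"
      then obtain b c where B: "B = quot_class b" "b \<lesssim> c" "c \<in> below S a"
        unfolding a(2) quot_below[OF a(1)] by blast
      obtain k where "c \<prec>\<^bsub>S\<^esub> s k" using B s(3) by blast
      then have "c \<in> below S (s k)" using B belowD belowI by blast
      then show "\<exists>k. B \<prec>\<^bsub>quot_W G S \<phi>\<^esub> quot_class (s k)"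
        using B quot_prec s_closed leG_carrier by blast
    qed
  next
    fix A B A' B'
    assume "A \<in> carrier (quot_W G S \<phi>)" "B \<in> carrier (quot_W G S \<phi>)"
      and A'B': "A' \<in> below (quot_W G S \<phi>) A" "B' \<in> below (quot_W G S \<phi>) B"
    then obtain a b where ab: "a \<in> carrier S" "b \<in> carrier S" "A = quot_class a" "B = quot_class b"
      unfolding carrier_quot by blast
    then obtain a' b' c d where c: "A' = quot_class a'" "B' = quot_class b'" "a' \<lesssim> c" "b' \<lesssim> d"
      "c \<in> below S a" "d \<in> below S b"
      using A'B' quot_below by auto
    have "a' \<otimes>\<^bsub>S\<^esub> b' \<lesssim> c \<otimes>\<^bsub>S\<^esub> d" by (rule leG_mult[OF c(3,4)])
    moreover have "c \<otimes>\<^bsub>S\<^esub> d \<in> below S (a \<otimes>\<^bsub>S\<^esub> b)" using ab c by (intro below_mult) auto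
    ultimately show "A' \<otimes>\<^bsub>quot_W G S \<phi>\<^esub> B' \<prec>\<^bsub>quot_W G S \<phi>\<^esub> A \<otimes>\<^bsub>quot_W G S \<phi>\<^esub> B"
      using ab c(1-4) leG_carrier[of a' c] leG_carrier[of b' d] quot_prec[of "a' \<otimes>\<^bsub>S\<^esub> b'" "a \<otimes>\<^bsub>S\<^esub> b"]
      by (auto simp: quot_mult)
  next
    fix A B C
    assume "A \<in> carrier (quot_W G S \<phi>)" "B \<in> carrier (quot_W G S \<phi>)" "C \<in> carrier (quot_W G S \<phi>)"
      and prec: "A \<prec>\<^bsub>quot_W G S \<phi>\<^esub> B \<otimes>\<^bsub>quot_W G S \<phi>\<^esub> C"
    then obtain a b c where abc: "a \<in> carrier S" "b \<in> carrier S" "c \<in> carrier S"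
      "A = quot_class a" "B = quot_class b" "C = quot_class c" unfolding carrier_quot by blast
    then obtain d where d: "a \<lesssim> d" "d \<in> below S (b \<otimes>\<^bsub>S\<^esub> c)"
      using prec quot_prec[of a "b \<otimes>\<^bsub>S\<^esub> c"] by (auto simp: quot_mult)
    obtain b' c' where b'c': "b' \<in> below S b" "c' \<in> below S c" "d \<in> below S (b' \<otimes>\<^bsub>S\<^esub> c')"
      using below_multE[OF abc(2,3) d(2)] by blast
    have car: "b' \<in> carrier S" "c' \<in> carrier S" using b'c' belowD by auto
    have "quot_class b' \<in> below (quot_W G S \<phi>) B" "quot_class c' \<in> below (quot_W G S \<phi>) C"
      unfolding abc quot_below[OF abc(2)] quot_below[OF abc(3)] using b'c' le_G_refl[OF car(1)] le_G_refl[OF car(2)] by blast+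
    moreover have "A \<prec>\<^bsub>quot_W G S \<phi>\<^esub> quot_class b' \<otimes>\<^bsub>quot_W G S \<phi>\<^esub> quot_class c'"
      using abc car d b'c' quot_prec[of a "b' \<otimes>\<^bsub>S\<^esub> c'"] by (auto simp: quot_mult)
    ultimately show "\<exists>B'\<in>below (quot_W G S \<phi>) B. \<exists>C'\<in>below (quot_W G S \<phi>) C.
        A \<prec>\<^bsub>quot_W G S \<phi>\<^esub> B' \<otimes>\<^bsub>quot_W G S \<phi>\<^esub> C'" by blast
  qed
qed

lemma almost_unperforated_quot_iff:
  "almost_unperforated_W (quot_W G S \<phi>) \<longleftrightarrow>
    (\<forall>a\<in>carrier S. \<forall>b\<in>carrier S.
      (\<exists>k::nat. \<exists>c\<in>below S (b [^]\<^bsub>S\<^esub> k). a [^]\<^bsub>S\<^esub> (k + 1) \<lesssim> c) \<longrightarrow> a \<lesssim> b)"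
proof -
  have pow: "quot_class a [^]\<^bsub>quot_W G S \<phi>\<^esub> (k + 1) \<prec>\<^bsub>quot_W G S \<phi>\<^esub> quot_class b [^]\<^bsub>quot_W G S \<phi>\<^esub> k
      \<longleftrightarrow> (\<exists>c\<in>below S (b [^]\<^bsub>S\<^esub> k). a [^]\<^bsub>S\<^esub> (k + 1) \<lesssim> c)"
    if "a \<in> carrier S" "b \<in> carrier S" for a b and k :: nat
    unfolding quot_pow[OF that(1)] quot_pow[OF that(2)] using that by (intro quot_prec) auto
  show ?thesis
    unfolding almost_unperforated_W_def carrier_quot
    by (simp only: ball_simps pow quot_le_prec cong: ball_cong)
qed

section \<open>Dynamical comparison\<close>

text \<open>These are the finite sums of translates in \<open>I_G\<close>, including the empty sum.
  Their inductive form yields closure properties without reindexing \<open>finprod\<close>.\<close>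

inductive_set orbit_sums for b where
  orbit_sums_one: "\<one>\<^bsub>S\<^esub> \<in> orbit_sums b"
| orbit_sums_mult_act: "\<lbrakk>u \<in> orbit_sums b; g \<in> carrier G\<rbrakk> \<Longrightarrow> u \<otimes>\<^bsub>S\<^esub> \<phi> g b \<in> orbit_sums b"

lemma orbit_sums_closed: "\<lbrakk>b \<in> carrier S; u \<in> orbit_sums b\<rbrakk> \<Longrightarrow> u \<in> carrier S"
  by (rotate_tac, induct rule: orbit_sums.induct) auto

lemma orbit_sums_iff_finprod:
  assumes b: "b \<in> carrier S"
  shows "u \<in> orbit_sums b \<longleftrightarrow>
    (\<exists>(n::nat) g. (\<forall>i\<in>{1..n}. g i \<in> carrier G) \<and> u = finprod S (\<lambda>i. \<phi> (g i) b) {1..n})"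
proof
  have step: "finprod S (\<lambda>i. \<phi> (g i) b) {1..Suc n} = finprod S (\<lambda>i. \<phi> (g i) b) {1..n} \<otimes>\<^bsub>S\<^esub> \<phi> (g (Suc n)) b"
    if "\<forall>i\<in>{1..Suc n}. g i \<in> carrier G" for n and g :: "nat \<Rightarrow> _"
  proof -
    have ins: "insert (Suc n) {1..n} = {1..Suc n}" by auto
    have "finprod S (\<lambda>i. \<phi> (g i) b) (insert (Suc n) {1..n})
        = \<phi> (g (Suc n)) b \<otimes>\<^bsub>S\<^esub> finprod S (\<lambda>i. \<phi> (g i) b) {1..n}"
      using that b by (intro finprod_insert) auto
    moreover have "finprod S (\<lambda>i. \<phi> (g i) b) {1..n} \<in> carrier S"
      using that b by (intro finprod_closed) auto
    ultimately show ?thesis unfolding ins using that b by (simp add: m_comm)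
  qed
  {
    assume "u \<in> orbit_sums b"
    then show "\<exists>(n::nat) g. (\<forall>i\<in>{1..n}. g i \<in> carrier G) \<and> u = finprod S (\<lambda>i. \<phi> (g i) b) {1..n}"
    proof induct
      case orbit_sums_one
      show ?case by (intro exI[of _ 0]) auto
    next
      case (orbit_sums_mult_act u h)
      then obtain n :: nat and g where g: "\<forall>i\<in>{1..n}. g i \<in> carrier G"
        and u: "u = finprod S (\<lambda>i. \<phi> (g i) b) {1..n}" by blast
      define g' where "g' = g(Suc n := h)"
      have g': "\<forall>i\<in>{1..Suc n}. g' i \<in> carrier G" using g orbit_sums_mult_act by (auto simp: g'_def)
      have "u = finprod S (\<lambda>i. \<phi> (g' i) b) {1..n}"
        unfolding u using g b by (intro finprod_cong') (auto simp: g'_def)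
      then have "u \<otimes>\<^bsub>S\<^esub> \<phi> h b = finprod S (\<lambda>i. \<phi> (g' i) b) {1..Suc n}"
        using step[OF g'] by (simp add: g'_def)
      then show ?case using g' by blast
    qed
  next
    assume "\<exists>(n::nat) g. (\<forall>i\<in>{1..n}. g i \<in> carrier G) \<and> u = finprod S (\<lambda>i. \<phi> (g i) b) {1..n}"
    then obtain n :: nat and g where g: "\<forall>i\<in>{1..n}. g i \<in> carrier G"
        and u: "u = finprod S (\<lambda>i. \<phi> (g i) b) {1..n}" by blast
    from g show "u \<in> orbit_sums b" unfolding u
    proof (induct n)
      case 0
      then show ?case by (simp add: orbit_sums_one)
    next
      case (Suc n)
      then have "finprod S (\<lambda>i. \<phi> (g i) b) {1..n} \<in> orbit_sums b" by simp
      then show ?case unfolding step[OF Suc(2)] using Suc(2) by (intro orbit_sums_mult_act) auto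
    qed
  }
qed

lemma mem_I_G:
  "b \<in> carrier S \<Longrightarrow>
    z \<in> I_G G S \<phi> b \<longleftrightarrow> z \<in> carrier S \<and> (\<forall>c\<in>below S z. \<exists>u\<in>orbit_sums b. c \<in> below S u)"
  unfolding I_G_def using orbit_sums_iff_finprod[of b] by (auto simp: below_def) metis+

lemma orbit_sums_mult:
  assumes "b \<in> carrier S" "u \<in> orbit_sums b" "v \<in> orbit_sums b"
  shows "u \<otimes>\<^bsub>S\<^esub> v \<in> orbit_sums b"
  using assms(3)
proof induct
  case orbit_sums_one
  then show ?case using assms orbit_sums_closed by simp
next
  case (orbit_sums_mult_act v g)
  then have "(u \<otimes>\<^bsub>S\<^esub> v) \<otimes>\<^bsub>S\<^esub> \<phi> g b \<in> orbit_sums b" by (intro orbit_sums.orbit_sums_mult_act)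
  then show ?case using assms orbit_sums_mult_act orbit_sums_closed by (simp add: m_assoc)
qed

lemma orbit_sums_act:
  assumes "b \<in> carrier S" "g \<in> carrier G" "u \<in> orbit_sums b"
  shows "\<phi> g u \<in> orbit_sums b"
  using assms(3)
proof induct
  case orbit_sums_one
  then show ?case using assms by (simp add: act_one orbit_sums.orbit_sums_one)
next
  case (orbit_sums_mult_act u h)
  have "\<phi> g (u \<otimes>\<^bsub>S\<^esub> \<phi> h b) = \<phi> g u \<otimes>\<^bsub>S\<^esub> \<phi> g (\<phi> h b)"
    using orbit_sums_mult_act assms orbit_sums_closed by (intro action_add) auto
  also have "\<phi> g (\<phi> h b) = \<phi> (g \<otimes>\<^bsub>G\<^esub> h) b"
    using orbit_sums_mult_act assms by (simp add: composition_rule)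
  finally show ?case
    using orbit_sums_mult_act assms group.is_monoid[OF group_G]
    by (auto intro!: orbit_sums.orbit_sums_mult_act monoid.m_closed)
qed

lemma orbit_sums_base: "b \<in> carrier S \<Longrightarrow> b \<in> orbit_sums b"
  using orbit_sums_mult_act[OF orbit_sums_one, of "\<one>\<^bsub>G\<^esub>" b]
    monoid.one_closed[OF group.is_monoid[OF group_G]]
  by (simp add: act_group_one)

lemma I_G_closed: "z \<in> I_G G S \<phi> b \<Longrightarrow> z \<in> carrier S"
  by (simp add: I_G_def)

lemma orbit_sums_I_G: "\<lbrakk>b \<in> carrier S; u \<in> orbit_sums b\<rbrakk> \<Longrightarrow> u \<in> I_G G S \<phi> b"
  using mem_I_G orbit_sums_closed by blast

lemma I_G_mult:
  assumes b: "b \<in> carrier S" and x: "x \<in> I_G G S \<phi> b" and y: "y \<in> I_G G S \<phi> b"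
  shows "x \<otimes>\<^bsub>S\<^esub> y \<in> I_G G S \<phi> b"
  unfolding mem_I_G[OF b]
proof (intro conjI ballI)
  have car: "x \<in> carrier S" "y \<in> carrier S" using x y I_G_closed by auto
  then show "x \<otimes>\<^bsub>S\<^esub> y \<in> carrier S" by simp
  fix c assume "c \<in> below S (x \<otimes>\<^bsub>S\<^esub> y)"
  then obtain x' y' where xy: "x' \<in> below S x" "y' \<in> below S y" "c \<in> below S (x' \<otimes>\<^bsub>S\<^esub> y')"
    using below_multE[OF car] by blast
  obtain u v where uv: "u \<in> orbit_sums b" "v \<in> orbit_sums b" "x' \<in> below S u" "y' \<in> below S v"
    using xy x y unfolding mem_I_G[OF b] by blast
  have "u \<in> carrier S" "v \<in> carrier S" using uv orbit_sums_closed[OF b] by auto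
  then have "c \<in> below S (u \<otimes>\<^bsub>S\<^esub> v)"
    using below_trans[OF _ below_mult[OF _ _ uv(3,4)] xy(3)] by simp
  then show "\<exists>u\<in>orbit_sums b. c \<in> below S u" using orbit_sums_mult[OF b] uv by blast
qed

lemma I_G_act:
  assumes b: "b \<in> carrier S" and x: "x \<in> I_G G S \<phi> b" and g: "g \<in> carrier G"
  shows "\<phi> g x \<in> I_G G S \<phi> b"
  unfolding mem_I_G[OF b]
proof (intro conjI ballI)
  show "\<phi> g x \<in> carrier S" using x g I_G_closed by simp
  fix c assume c: "c \<in> below S (\<phi> g x)"
  then have "\<phi> (inv\<^bsub>G\<^esub> g) c \<in> below S x" using g x I_G_closed act_below_inv by blast
  then obtain u where u: "u \<in> orbit_sums b" "\<phi> (inv\<^bsub>G\<^esub> g) c \<in> below S u"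
    using x unfolding mem_I_G[OF b] by blast
  then have "\<phi> g (\<phi> (inv\<^bsub>G\<^esub> g) c) \<in> below S (\<phi> g u)"
    using g orbit_sums_closed[OF b] by (intro act_below) auto
  then show "\<exists>u\<in>orbit_sums b. c \<in> below S u"
    using u orbit_sums_act[OF b g] act_act_inv[OF g belowD(1)[OF c]] by auto
qed

text \<open>As \<open>I_G\<close> of \<open>b\<close> is closed under addition and translation, it
  contains all orbit sums of \<open>y\<close>; anything below such a sum is then below an orbit sum
  of \<open>b\<close>.\<close>

lemma I_G_trans:
  assumes b: "b \<in> carrier S" and y: "y \<in> I_G G S \<phi> b" and x: "x \<in> I_G G S \<phi> y"
  shows "x \<in> I_G G S \<phi> b"
proof -
  have yS: "y \<in> carrier S" using y by (rule I_G_closed)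
  have "u \<in> I_G G S \<phi> b" if "u \<in> orbit_sums y" for u
    using that by induct (auto intro: I_G_mult I_G_act b y orbit_sums_I_G orbit_sums_one)
  then show ?thesis using x unfolding mem_I_G[OF yS] mem_I_G[OF b] by blast
qed

text \<open>Induction on the generation of \<open>\<le>\<^sub>G\<close>. Together with
  \<open>I_G_trans\<close> it makes \<open>I_G\<close> of an element downward closed for
  \<open>\<le>\<^sub>G\<close>.\<close>

lemma leG_I_G: "x \<lesssim> y \<Longrightarrow> x \<in> I_G G S \<phi> y"
proof (induct rule: le_G.induct)
  case (le_G_refl a)
  then show ?case by (intro orbit_sums_I_G orbit_sums_base)
next
  case (le_G_trans a b c)
  then show ?case using I_G_trans leG_carrier by meson
next
  case (le_G_prec a b)
  then show ?case
    unfolding mem_I_G[OF le_G_prec(2)] le_prec_def using orbit_sums_base by blast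
next
  case (le_G_action b g a)
  then show ?case using I_G_act[of b b g] orbit_sums_I_G[OF _ orbit_sums_base] by simp
next
  case (le_G_approx a b)
  show ?case
    unfolding mem_I_G[OF le_G_approx(2)]
  proof (intro conjI ballI)
    fix c assume "c \<in> below S a"
    then obtain d where "d \<in> below S a" "c \<in> below S d"
      using below_interpolate[OF le_G_approx(1)] by blast
    then show "\<exists>u\<in>orbit_sums b. c \<in> below S u"
      using le_G_approx(3) unfolding mem_I_G[OF le_G_approx(2)] by blast
  qed (rule le_G_approx(1))
next
  case (le_G_add a1 b1 a2 b2 a b)
  have car [simp]: "b1 \<in> carrier S" "b2 \<in> carrier S" using le_G_add leG_carrier by blast+
  \<comment> \<open>Adding 0, which is below \<open>y\<close>, shows that everything below
    \<open>x\<close> is below x + y.\<close>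
  have summand: "x \<in> I_G G S \<phi> (x \<otimes>\<^bsub>S\<^esub> y)" if [simp]: "x \<in> carrier S" "y \<in> carrier S" for x y
  proof -
    have "below S x \<subseteq> below S (x \<otimes>\<^bsub>S\<^esub> y)"
      using below_mult[of x y _ "\<one>\<^bsub>S\<^esub>"] one_below[of y] belowD by fastforce
    then show ?thesis
      using orbit_sums_base[of "x \<otimes>\<^bsub>S\<^esub> y"] by (subst mem_I_G) auto
  qed
  have "b1 \<in> I_G G S \<phi> b" "b2 \<in> I_G G S \<phi> b"
    using summand[of b1 b2] summand[of b2 b1] le_G_add by (auto simp: m_comm)
  then have "a1 \<in> I_G G S \<phi> b" "a2 \<in> I_G G S \<phi> b"
    using le_G_add I_G_trans[of b b1 a1] I_G_trans[of b b2 a2] by auto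
  then show ?case using le_G_add I_G_mult[of b a1 a2] by simp
qed

section \<open>Invariant states and their regularisation\<close>

lemma St_GD:
  assumes "l \<in> St_G G S \<phi>"
  shows "\<lbrakk>a \<in> carrier S; b \<in> carrier S\<rbrakk> \<Longrightarrow> l (a \<otimes>\<^bsub>S\<^esub> b) = l a + l b" "l \<one>\<^bsub>S\<^esub> = 0"
    "\<lbrakk>a \<in> carrier S; b \<in> carrier S; le_prec S a b\<rbrakk> \<Longrightarrow> l a \<le> l b"
    "\<lbrakk>g \<in> carrier G; a \<in> carrier S\<rbrakk> \<Longrightarrow> l (\<phi> g a) = l a"
  using assms by (auto simp: St_G_def)

lemma St_G_below: "\<lbrakk>l \<in> St_G G S \<phi>; a \<in> carrier S; b \<in> below S a\<rbrakk> \<Longrightarrow> l b \<le> l a"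
  using St_GD(3)[of l b a] le_prec_below[of a b] belowD(1)[of b a] by simp

lemma St_G_pow: "\<lbrakk>l \<in> St_G G S \<phi>; a \<in> carrier S\<rbrakk> \<Longrightarrow> l (a [^]\<^bsub>S\<^esub> (n::nat)) = of_nat n * l a"
  by (induct n) (auto simp: St_GD algebra_simps)

lemma F_W_GD:
  assumes "l \<in> F_W_G G S \<phi>"
  shows "l \<in> St_G G S \<phi>" "a \<in> carrier S \<Longrightarrow> l a = (SUP b\<in>below S a. l b)"
  using assms by (auto simp: F_W_G_def)

text \<open>Regularity is used for the approximation clause; the other generating clauses follow
  from the properties of \<open>St_G\<close>.\<close>

lemma F_W_G_mono:
  assumes l: "l \<in> F_W_G G S \<phi>" and "a \<lesssim> b"
  shows "l a \<le> l b"
  using assms(2)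
proof (induct rule: le_G.induct)
  case (le_G_approx a b)
  then show ?case unfolding F_W_GD(2)[OF l le_G_approx(1)] by (auto intro: SUP_least)
next
  case (le_G_add a1 b1 a2 b2 a b)
  then have "a1 \<in> carrier S" "b1 \<in> carrier S" "a2 \<in> carrier S" "b2 \<in> carrier S"
    using leG_carrier by blast+
  then show ?case using le_G_add St_GD(1)[OF F_W_GD(1)[OF l]] by (simp add: add_mono)
qed (use St_GD[OF F_W_GD(1)[OF l]] in auto)

definition regularisation where
  "regularisation l x = (SUP y\<in>below S x. l y :: ennreal)"

lemma regularisation_upper: "y \<in> below S x \<Longrightarrow> l y \<le> regularisation l x"
  unfolding regularisation_def by (rule SUP_upper)

lemma regularisation_le: "\<lbrakk>l \<in> St_G G S \<phi>; x \<in> carrier S\<rbrakk> \<Longrightarrow> regularisation l x \<le> l x"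
  unfolding regularisation_def by (intro SUP_least St_G_below)

text \<open>Subadditivity comes from \<open>W4\<close>, superadditivity from \<open>W3\<close>, and
  the supremum formula from interpolation.\<close>

lemma regularisation_F_W_G:
  assumes l: "l \<in> St_G G S \<phi>"
  shows "regularisation l \<in> F_W_G G S \<phi>"
proof -
  have mult: "regularisation l (x \<otimes>\<^bsub>S\<^esub> y) = regularisation l x + regularisation l y"
    if x: "x \<in> carrier S" and y: "y \<in> carrier S" for x y
  proof (rule antisym)
    show "regularisation l (x \<otimes>\<^bsub>S\<^esub> y) \<le> regularisation l x + regularisation l y"
      unfolding regularisation_def[of l "x \<otimes>\<^bsub>S\<^esub> y"]
    proof (rule SUP_least)
      fix z assume "z \<in> below S (x \<otimes>\<^bsub>S\<^esub> y)"
      then obtain x' y' where xy: "x' \<in> below S x" "y' \<in> below S y" "z \<in> below S (x' \<otimes>\<^bsub>S\<^esub> y')"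
        using below_multE[OF x y] by blast
      have car: "x' \<in> carrier S" "y' \<in> carrier S" using xy belowD by auto
      have "l z \<le> l (x' \<otimes>\<^bsub>S\<^esub> y')" using St_G_below[OF l _ xy(3)] car by simp
      also have "\<dots> = l x' + l y'" using St_GD(1)[OF l car] .
      also have "\<dots> \<le> regularisation l x + regularisation l y"
        by (intro add_mono regularisation_upper xy)
      finally show "l z \<le> regularisation l x + regularisation l y" .
    qed
  next
    have ne: "below S x \<noteq> {}" "below S y \<noteq> {}" using one_below x y by blast+
    have "l x' + l y' \<le> regularisation l (x \<otimes>\<^bsub>S\<^esub> y)" if "x' \<in> below S x" "y' \<in> below S y" for x' y'
    proof -
      have "l x' + l y' = l (x' \<otimes>\<^bsub>S\<^esub> y')" using St_GD(1)[OF l] that belowD(1) by simp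
      also have "\<dots> \<le> regularisation l (x \<otimes>\<^bsub>S\<^esub> y)"
        using below_mult[OF x y that] by (rule regularisation_upper)
      finally show ?thesis .
    qed
    \<comment> \<open>The two suprema are taken one after the other. Moving a supremum past a
      summand requires nonempty index sets, which is why \<open>ne\<close> was recorded.\<close>
    then have "l x' + regularisation l y \<le> regularisation l (x \<otimes>\<^bsub>S\<^esub> y)" if "x' \<in> below S x" for x'
      unfolding regularisation_def[of l y] ennreal_SUP_add_right[OF ne(2)] using that by (intro SUP_least)
    then have "regularisation l y + regularisation l x \<le> regularisation l (x \<otimes>\<^bsub>S\<^esub> y)"
      unfolding regularisation_def[of l x] ennreal_SUP_add_right[OF ne(1)]
      by (intro SUP_least) (simp add: add.commute)
    then show "regularisation l x + regularisation l y \<le> regularisation l (x \<otimes>\<^bsub>S\<^esub> y)"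
      by (simp add: add.commute)
  qed
  have one: "regularisation l \<one>\<^bsub>S\<^esub> = 0"
    using regularisation_le[OF l one_closed] St_GD(2)[OF l] by simp
  have mono: "regularisation l x \<le> regularisation l y" if "le_prec S x y" for x y
    using that unfolding le_prec_def regularisation_def by (intro SUP_subset_mono) auto
  have act_le: "regularisation l (\<phi> g x) \<le> regularisation l x"
    if "g \<in> carrier G" "x \<in> carrier S" for g x
    unfolding regularisation_def[of l "\<phi> g x"]
  proof (rule SUP_least)
    fix z assume z: "z \<in> below S (\<phi> g x)"
    have "l z = l (\<phi> (inv\<^bsub>G\<^esub> g) z)" using St_GD(4)[OF l] that belowD(1)[OF z] by simp
    also have "\<dots> \<le> regularisation l x" by (intro regularisation_upper act_below_inv that z)
    finally show "l z \<le> regularisation l x" .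
  qed
  \<comment> \<open>The reverse inequality is \<open>act_le\<close> for the inverse element at the
    translated point.\<close>
  have act: "regularisation l (\<phi> g x) = regularisation l x" if "g \<in> carrier G" "x \<in> carrier S" for g x
    using act_le[OF that] act_le[of "inv\<^bsub>G\<^esub> g" "\<phi> g x"] that by (simp add: act_inv_act)
  have "regularisation l x = (SUP y\<in>below S x. regularisation l y)" if x: "x \<in> carrier S" for x
  proof (rule antisym)
    show "regularisation l x \<le> (SUP y\<in>below S x. regularisation l y)"
      unfolding regularisation_def[of l x]
    proof (rule SUP_least)
      fix z assume "z \<in> below S x"
      then obtain d where d: "d \<in> below S x" "z \<in> below S d" using below_interpolate[OF x] by blast
      have "l z \<le> regularisation l d" using d(2) by (rule regularisation_upper)
      also have "\<dots> \<le> (SUP y\<in>below S x. regularisation l y)" using d(1) by (rule SUP_upper)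
      finally show "l z \<le> (SUP y\<in>below S x. regularisation l y)" .
    qed
  next
    show "(SUP y\<in>below S x. regularisation l y) \<le> regularisation l x"
      using le_prec_below[OF x] by (intro SUP_least mono)
  qed
  then show ?thesis unfolding F_W_G_def St_G_def using mult one mono act by blast
qed

text \<open>Vanishing at \<open>b\<close> passes to orbit sums, then to the elements below
  \<open>a\<close>, and by regularity to \<open>a\<close>. It covers the states that the condition 0
  < l(b) in dynamical strict comparison leaves out.\<close>

lemma F_W_G_I_G_zero:
  assumes l: "l \<in> F_W_G G S \<phi>" and b: "b \<in> carrier S" and a: "a \<in> I_G G S \<phi> b" and "l b = 0"
  shows "l a = 0"
proof -
  note St = St_GD[OF F_W_GD(1)[OF l]]
  have "l u = 0" if "u \<in> orbit_sums b" for u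
    using that by induct (use St b \<open>l b = 0\<close> orbit_sums_closed in auto)
  then have "l c \<le> 0" if "c \<in> below S a" for c
    using a that St_G_below[OF F_W_GD(1)[OF l]] orbit_sums_closed[OF b] unfolding mem_I_G[OF b] by metis
  then have "l a \<le> 0" unfolding F_W_GD(2)[OF l I_G_closed[OF a]] by (intro SUP_least)
  then show ?thesis by simp
qed

text \<open>Each translate of \<open>b\<close> is at most \<open>b\<close> for
  \<open>\<le>\<^sub>G\<close>, so orbit sums are dominated by plain multiples.\<close>

lemma orbit_sums_order_ideal:
  assumes b: "b \<in> carrier S" and "u \<in> orbit_sums b"
  shows "u \<in> preordered.order_ideal b"
  using assms(2)
proof induct
  case orbit_sums_one
  show ?case unfolding preordered.order_ideal_def by (auto intro!: exI[of _ 0] le_G_refl)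
next
  case (orbit_sums_mult_act u g)
  have "\<phi> g b \<lesssim> b [^]\<^bsub>S\<^esub> (1::nat)" using leG_actI[OF _ b] orbit_sums_mult_act b by simp
  then have "\<phi> g b \<in> preordered.order_ideal b"
    unfolding preordered.order_ideal_def using act_closed[OF orbit_sums_mult_act(3) b] by blast
  then show ?case
    using orbit_sums_mult_act b orbit_sums_closed by (subst preordered.order_ideal_mult_iff) auto
qed

section \<open>The implications between the comparison conditions\<close>

abbreviation "St_G_strict_comparison \<equiv>
  (\<forall>a\<in>carrier S. \<forall>b\<in>carrier S. a \<in> I_G G S \<phi> b \<longrightarrow>
    (\<forall>l\<in>St_G G S \<phi>. l b = 1 \<longrightarrow> l a < l b) \<longrightarrow> le_G G S \<phi> a b)"

lemma almost_unperforated_imp_St_G_comparison: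
  assumes "almost_unperforated_W (quot_W G S \<phi>)"
  shows St_G_strict_comparison
proof (intro ballI impI)
  fix a b assume a: "a \<in> carrier S" and b: "b \<in> carrier S" and ab: "a \<in> I_G G S \<phi> b"
    and states: "\<forall>l\<in>St_G G S \<phi>. l b = 1 \<longrightarrow> l a < l b"
  have "c \<lesssim> b" if c: "c \<in> below S a" for c
  proof -
    \<comment> \<open>Two elements below \<open>a\<close> are used: \<open>d\<close> lies under an
      orbit sum, hence in the order ideal of \<open>b\<close>, and the passage from \<open>d\<close>
      to \<open>c\<close> turns (k + 1) d <= k b into domination of (k + 1) c by an element strictly
      below k b, as almost unperforation asks.\<close>
    obtain d where d: "d \<in> below S a" "c \<in> below S d" using below_interpolate[OF a c] by blast
    have dS: "d \<in> carrier S" and cS: "c \<in> carrier S" using d belowD by auto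
    obtain u where u: "u \<in> orbit_sums b" "d \<in> below S u" using ab d unfolding mem_I_G[OF b] by blast
    have uS: "u \<in> carrier S" using orbit_sums_closed[OF b u(1)] .
    have "d \<in> preordered.order_ideal b"
      using preordered.order_ideal_downward[OF b dS orbit_sums_order_ideal[OF b u(1)]]
        leG_belowI[OF uS u(2)] by blast
    then have "\<exists>k::nat. d [^]\<^bsub>S\<^esub> Suc k \<lesssim> b [^]\<^bsub>S\<^esub> k"
    proof (rule preordered.states_strict_comparison[OF dS b])
      fix l :: "_ \<Rightarrow> ennreal"
      assume add: "\<And>x y. \<lbrakk>x \<in> carrier S; y \<in> carrier S\<rbrakk> \<Longrightarrow> l (x \<otimes>\<^bsub>S\<^esub> y) = l x + l y"
        and one: "l \<one>\<^bsub>S\<^esub> = 0"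
        and mono: "\<And>x y. \<lbrakk>x \<in> carrier S; y \<in> carrier S; x \<lesssim> y\<rbrakk> \<Longrightarrow> l x \<le> l y" and lb: "l b = 1"
      \<comment> \<open>Monotonicity for \<open>\<le>\<^sub>G\<close> forces invariance, because
        \<open>x\<close> and its translates dominate each other.\<close>
      have "l (\<phi> g x) = l x" if "g \<in> carrier G" "x \<in> carrier S" for g x
        using mono[OF _ _ leG_actI[OF that]] mono[OF _ _ leG_actI'[OF that]] that by simp
      moreover have "l x \<le> l y" if "x \<in> carrier S" "y \<in> carrier S" "le_prec S x y" for x y
        by (rule mono[OF that(1,2) le_G_prec[OF that]])
      ultimately have "l \<in> St_G G S \<phi>"
        unfolding St_G_def using add one by simp
      then have "l a < 1" using states lb by metis
      moreover have "l d \<le> l a" by (intro mono dS a leG_belowI d)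
      ultimately show "l d < 1" by simp
    qed
    then obtain k :: nat where k: "d [^]\<^bsub>S\<^esub> (k + 1) \<lesssim> b [^]\<^bsub>S\<^esub> k" by auto
    have "c [^]\<^bsub>S\<^esub> (k + 1) \<in> below S (d [^]\<^bsub>S\<^esub> (k + 1))" by (rule below_pow[OF dS d(2)])
    with k obtain e where "e \<in> below S (b [^]\<^bsub>S\<^esub> k)" "c [^]\<^bsub>S\<^esub> (k + 1) \<lesssim> e"
      by (rule leG_belowE)
    then show "c \<lesssim> b" using assms cS b unfolding almost_unperforated_quot_iff by blast
  qed
  then show "a \<lesssim> b" using a b by (intro le_G_approx) auto
qed

text \<open>For \<open>c\<close> below \<open>a\<close> and l(b) = 1, let r be the regularisation of
  \<open>l\<close>. When r(b) > 0, the chain l(c) <= r(a) < r(b) <= 1 gives the strict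
  inequality.\<close>

lemma St_G_comparison_imp_dynamical:
  assumes St_G_strict_comparison
  shows "dynamical_strict_comparison G S \<phi>"
  unfolding dynamical_strict_comparison_def
proof (intro ballI impI)
  fix a b assume a: "a \<in> carrier S" and b: "b \<in> carrier S" and ab: "a \<in> I_G G S \<phi> b"
    and states: "\<forall>l\<in>F_W_G G S \<phi>. 0 < l b \<and> l b < \<infinity> \<longrightarrow> l a < l b"
  have "c \<lesssim> b" if c: "c \<in> below S a" for c
  proof -
    have cS: "c \<in> carrier S" using c belowD by blast
    have "c \<in> I_G G S \<phi> b"
      using I_G_trans[OF b ab leG_I_G[OF leG_belowI[OF a c]]] .
    moreover have "l c < l b" if l: "l \<in> St_G G S \<phi>" and lb: "l b = 1" for l
    proof -
      have F: "regularisation l \<in> F_W_G G S \<phi>" using l by (rule regularisation_F_W_G)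
      have ca: "l c \<le> regularisation l a" using c by (rule regularisation_upper)
      have le1: "regularisation l b \<le> 1" using regularisation_le[OF l b] lb by simp
      show ?thesis
      \<comment> \<open>If the regularisation vanishes at \<open>b\<close>, the assumption on
        \<open>F_W_G\<close> says nothing about it; membership of \<open>a\<close> in
        \<open>I_G\<close> makes it vanish at \<open>a\<close> too, so l(c) = 0 < 1.\<close>
      proof (cases "regularisation l b = 0")
        case True
        then have "regularisation l a = 0" using F_W_G_I_G_zero[OF F b ab] by simp
        then show ?thesis using ca lb by simp
      next
        case False
        then have "0 < regularisation l b" using zero_less_iff_neq_zero by blast
        moreover have "regularisation l b < \<infinity>" using le1 by (rule le_less_trans) simp
        ultimately have "regularisation l a < regularisation l b" using states F by blast
        then show ?thesis using ca le1 lb by simp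
      qed
    qed
    ultimately show "c \<lesssim> b" using assms cS b by blast
  qed
  then show "a \<lesssim> b" using a b by (intro le_G_approx) auto
qed

lemma dynamical_imp_almost_unperforated:
  assumes "dynamical_strict_comparison G S \<phi>"
  shows "almost_unperforated_W (quot_W G S \<phi>)"
  unfolding almost_unperforated_quot_iff
proof (intro ballI impI)
  fix a b assume a: "a \<in> carrier S" and b: "b \<in> carrier S"
    and "\<exists>k::nat. \<exists>c\<in>below S (b [^]\<^bsub>S\<^esub> k). a [^]\<^bsub>S\<^esub> (k + 1) \<lesssim> c"
  then obtain k :: nat and c where c: "c \<in> below S (b [^]\<^bsub>S\<^esub> k)" "a [^]\<^bsub>S\<^esub> (k + 1) \<lesssim> c" by blast
  have kab: "a [^]\<^bsub>S\<^esub> (k + 1) \<lesssim> b [^]\<^bsub>S\<^esub> k"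
    by (rule le_G_trans[OF c(2) leG_belowI[OF nat_pow_closed[OF b] c(1)]])
  \<comment> \<open>From a <= (k + 1) a <= k b, and k b being an element of \<open>I_G\<close> of
    \<open>b\<close>, the membership required by dynamical comparison follows.\<close>
  have "a [^]\<^bsub>S\<^esub> (1::nat) \<lesssim> a [^]\<^bsub>S\<^esub> (k + 1)" by (rule preordered.pow_le_pow_exp[OF a]) simp
  then have "a \<lesssim> b [^]\<^bsub>S\<^esub> k" using le_G_trans[OF _ kab] a by simp
  moreover have "b [^]\<^bsub>S\<^esub> k \<in> I_G G S \<phi> b"
    by (induct k) (auto intro: I_G_mult b orbit_sums_I_G orbit_sums_one orbit_sums_base)
  ultimately have "a \<in> I_G G S \<phi> b" using I_G_trans[OF b _ leG_I_G] by blast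
  moreover have "l a < l b" if l: "l \<in> F_W_G G S \<phi>" and lb: "0 < l b" "l b < \<infinity>" for l
  proof (rule ccontr)
    \<comment> \<open>If l(b) <= l(a), monotonicity yields (k + 1) l(b) <= k l(b); cancelling k
      l(b), which is finite, leaves l(b) <= 0.\<close>
    assume "\<not> l a < l b"
    then have "of_nat (k + 1) * l b \<le> of_nat (k + 1) * l a" by (intro mult_left_mono) auto
    also have "\<dots> = l (a [^]\<^bsub>S\<^esub> (k + 1))" using St_G_pow[OF F_W_GD(1)[OF l] a, of "k + 1"] by simp
    also have "\<dots> \<le> l (b [^]\<^bsub>S\<^esub> k)" using kab by (rule F_W_G_mono[OF l])
    also have "\<dots> = of_nat k * l b" by (rule St_G_pow[OF F_W_GD(1)[OF l] b])
    finally have *: "of_nat k * l b + l b \<le> of_nat k * l b + 0" by (simp add: algebra_simps)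
    have "of_nat k * l b \<noteq> \<infinity>" using lb(2) by (auto simp: ennreal_mult_eq_top_iff)
    then have "l b \<le> 0" using * by (subst (asm) ennreal_add_left_cancel_le) auto
    then show False using lb(1) by simp
  qed
  ultimately show "a \<lesssim> b" using assms a b unfolding dynamical_strict_comparison_def by blast
qed

end

theorem proposition11p5:
  fixes G :: "('g, 'h) monoid_scheme"
    and S :: "('a, 'm) w_semigroup_scheme"
    and \<phi> :: "'g \<Rightarrow> 'a \<Rightarrow> 'a"
  assumes "GW_semigroup G S \<phi>"
  shows "(dynamical_strict_comparison G S \<phi> \<longleftrightarrow>
           (\<forall>a\<in>carrier S. \<forall>b\<in>carrier S. a \<in> I_G G S \<phi> b \<longrightarrow>
             (\<forall>l\<in>St_G G S \<phi>. l b = 1 \<longrightarrow> l a < l b) \<longrightarrow> le_G G S \<phi> a b)) \<and>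
         ((\<forall>a\<in>carrier S. \<forall>b\<in>carrier S. a \<in> I_G G S \<phi> b \<longrightarrow>
             (\<forall>l\<in>St_G G S \<phi>. l b = 1 \<longrightarrow> l a < l b) \<longrightarrow> le_G G S \<phi> a b) \<longleftrightarrow>
           almost_unperforated_W (quot_W G S \<phi>)) \<and>
         (almost_unperforated_W (quot_W G S \<phi>) \<longleftrightarrow>
           almost_unperforated_Cu (gamma_W (quot_W G S \<phi>)))"
proof -
  interpret GW_semigroup G S \<phi> by (rule assms)
  \<comment> \<open>The three implications form a cycle from (iii) through (ii) and (i) back to
    (iii); (iv) joins by the completion theorem applied to S/G.\<close>
  show ?thesis
    using almost_unperforated_imp_St_G_comparison St_G_comparison_imp_dynamical
      dynamical_imp_almost_unperforated
      W_semigroup.almost_unperforated_W_iff_gamma[OF W_semigroup_quot] by argo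
qed

end
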